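(* Let $\mathcal{X}$ be a complete and separable metric space and let $\mathcal{Y}\subseteq\mathbb{R}$ be closed. Let $\mathrm{P}_1,\mathrm{P}_2\in\mathcal{M}_1(\mathcal{X}\times\mathcal{Y})$ be probability measures, let $\lambda_1,\lambda_2>0$, and let $k_1,k_2$ be measurable and bounded kernels on $\mathcal{X}$ with separable RKHSs $H_1,H_2$. Put $\kappa:=\max\{\|k_1\|_\infty,\|k_2\|_\infty\}$ and $\tau:=\min\{\lambda_1,\lambda_2\}$. Let $L$ be a convex and Lipschitz continuous loss function with Lipschitz constant $|L|_1$. Then, for all $p\in[1,\infty)$ and all $i\in\{1,2\}$, $$\|f_{\mathrm{P}_1,\lambda_1,k_1}-f_{\mathrm{P}_2,\lambda_2,k_2}\|_{L_p(\mathrm{P}_i^X)}\le\frac{|L|_1}{\tau}\cdot\left(\kappa^2\cdot\|\mathrm{P}_1-\mathrm{P}_2\|_{tv}+\frac{\kappa^2}{\tau}\cdot|\lambda_1-\lambda_2|+\frac12\cdot\|k_1-k_2\|_{L_p(\mathrm{P}_i^X\otimes\mathrm{P}_i^X)}+\kappa\cdot\sqrt{\|k_1-k_2\|_{L_p(\mathrm{P}_i^X\otimes\mathrm{P}_i^X)}}\right).$$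
   Context: All spaces carry their Borel $\sigma$-algebras; $\mathcal{M}_1(\mathcal{X}\times\mathcal{Y})$ is the set of Borel probability measures on $\mathcal{X}\times\mathcal{Y}$, and $\mathrm{P}^X$ denotes the marginal distribution on $\mathcal{X}$ of $\mathrm{P}\in\mathcal{M}_1(\mathcal{X}\times\mathcal{Y})$. A kernel on $\mathcal{X}$ is a symmetric positive semidefinite function $k:\mathcal{X}\times\mathcal{X}\to\mathbb{R}$; $H$ (with the same index as $k$) denotes its reproducing kernel Hilbert space (RKHS). For a kernel $k$, $\|k\|_\infty:=\sup_{x\in\mathcal{X}}\sqrt{k(x,x)}$, and $k$ is bounded if this is finite. A loss function is a measurable function $L:\mathcal{X}\times\mathcal{Y}\times\mathbb{R}\to[0,\infty)$. It is convex if $L(x,y,\cdot)$ is convex for all $(x,y)$, and Lipschitz continuous if there is $c\ge0$ with $|L(x,y,t_1)-L(x,y,t_2)|\le c|t_1-t_2|$ for all $x,y,t_1,t_2$; the smallest such $c$ is $|L|_1$. The shifted loss function is $L^\star(x,y,t):=L(x,y,t)-L(x,y,0)$, and $\mathcal{R}_{L^\star,\mathrm{P}}(f):=\mathbb{E}_{\mathrm{P}}[L^\star(X,Y,f(X))]$. The support vector machine (SVM) is $$f_{\mathrm{P},\lambda,k}:=\arg\inf_{f\in H}\ \mathcal{R}_{L^\star,\mathrm{P}}(f)+\lambda\|f\|_H^2,$$ which exists and is unique for $\mathrm{P}\in\mathcal{M}_1(\mathcal{X}\times\mathcal{Y})$, $\lambda>0$, $L$ convex and Lipschitz continuous and $k$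 bounded and measurable with separable RKHS (the loss $L$ is fixed and omitted from the notation). For a finite signed measure $\nu$, $\|\nu\|_{tv}:=\sup\{\sum_{i=1}^n|\nu(E_i)|: E_1,\dots,E_n \text{ a finite measurable partition of the whole space}\}$ is its total variation norm. *)

theory Defs
  imports "HOL-Probability.Probability"
begin

section \<open>Kernels and their reproducing kernel Hilbert spaces\<close>

definition is_kernel :: "('x \<Rightarrow> 'x \<Rightarrow> real) \<Rightarrow> bool" where
  "is_kernel k \<longleftrightarrow>
     (\<forall>x x'. k x x' = k x' x) \<and>
     (\<forall>(n::nat) (a :: nat \<Rightarrow> real) (x :: nat \<Rightarrow> 'x).
        0 \<le> (\<Sum>i<n. \<Sum>j<n. a i * a j * k (x i) (x j)))"

definition bounded_kernel :: "('x \<Rightarrow> 'x \<Rightarrow> real) \<Rightarrow> bool" where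
  "bounded_kernel k \<longleftrightarrow> bdd_above (range (\<lambda>x. sqrt (k x x)))"

definition kernel_sup_norm :: "('x \<Rightarrow> 'x \<Rightarrow> real) \<Rightarrow> real" where
  "kernel_sup_norm k = (SUP x. sqrt (k x x))"

text \<open>
  A space of real functions on \<open>'x\<close> is a set \<open>H\<close> together with a form \<open>ip\<close>; only the
  values of \<open>ip\<close> on pairs from \<open>H\<close> are relevant.
\<close>

definition fspace_norm ::
  "(('x \<Rightarrow> real) \<Rightarrow> ('x \<Rightarrow> real) \<Rightarrow> real) \<Rightarrow> ('x \<Rightarrow> real) \<Rightarrow> real" where
  "fspace_norm ip f = sqrt (ip f f)"

definition inner_product_fspace ::
  "('x \<Rightarrow> real) set \<Rightarrow> (('x \<Rightarrow> real) \<Rightarrow> ('x \<Rightarrow> real) \<Rightarrow> real) \<Rightarrow> bool" where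
  "inner_product_fspace H ip \<longleftrightarrow>
     (\<lambda>x. 0) \<in> H \<and>
     (\<forall>f\<in>H. \<forall>g\<in>H. (\<lambda>x. f x + g x) \<in> H) \<and>
     (\<forall>f\<in>H. \<forall>c. (\<lambda>x. c * f x) \<in> H) \<and>
     (\<forall>f\<in>H. \<forall>g\<in>H. ip f g = ip g f) \<and>
     (\<forall>f\<in>H. \<forall>g\<in>H. \<forall>h\<in>H. ip (\<lambda>x. f x + g x) h = ip f h + ip g h) \<and>
     (\<forall>f\<in>H. \<forall>g\<in>H. \<forall>c. ip (\<lambda>x. c * f x) g = c * ip f g) \<and>
     (\<forall>f\<in>H. 0 \<le> ip f f) \<and>
     (\<forall>f\<in>H. ip f f = 0 \<longrightarrow> f = (\<lambda>x. 0))"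

definition complete_fspace ::
  "('x \<Rightarrow> real) set \<Rightarrow> (('x \<Rightarrow> real) \<Rightarrow> ('x \<Rightarrow> real) \<Rightarrow> real) \<Rightarrow> bool" where
  "complete_fspace H ip \<longleftrightarrow>
     (\<forall>u :: nat \<Rightarrow> 'x \<Rightarrow> real.
        (\<forall>n. u n \<in> H) \<and>
        (\<forall>e>0. \<exists>N. \<forall>m\<ge>N. \<forall>n\<ge>N. fspace_norm ip (\<lambda>x. u m x - u n x) < e) \<longrightarrow>
        (\<exists>f\<in>H. (\<lambda>n. fspace_norm ip (\<lambda>x. u n x - f x)) \<longlonglongrightarrow> 0))"

definition separable_fspace ::
  "('x \<Rightarrow> real) set \<Rightarrow> (('x \<Rightarrow> real) \<Rightarrow> ('x \<Rightarrow> real) \<Rightarrow> real) \<Rightarrow> bool" where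
  "separable_fspace H ip \<longleftrightarrow>
     (\<exists>D\<subseteq>H. countable D \<and> (\<forall>f\<in>H. \<forall>e>0. \<exists>g\<in>D. fspace_norm ip (\<lambda>x. f x - g x) < e))"

definition is_rkhs ::
  "('x \<Rightarrow> 'x \<Rightarrow> real) \<Rightarrow> ('x \<Rightarrow> real) set \<Rightarrow> (('x \<Rightarrow> real) \<Rightarrow> ('x \<Rightarrow> real) \<Rightarrow> real) \<Rightarrow> bool" where
  "is_rkhs k H ip \<longleftrightarrow>
     inner_product_fspace H ip \<and> complete_fspace H ip \<and>
     (\<forall>x. (\<lambda>x'. k x' x) \<in> H) \<and>
     (\<forall>f\<in>H. \<forall>x. f x = ip f (\<lambda>x'. k x' x))"

section \<open>Loss functions\<close>

text \<open>
  A function on \<open>X \<times> Y \<times> \<real>\<close>, where \<open>X\<close> is the whole type \<open>'x\<close> and \<open>Y\<close> a set of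
  reals, is a curried function of which only the values with second argument in \<open>Y\<close> matter.
\<close>

definition is_loss :: "real set \<Rightarrow> ('x::topological_space \<Rightarrow> real \<Rightarrow> real \<Rightarrow> real) \<Rightarrow> bool" where
  "is_loss Y L \<longleftrightarrow>
     (\<lambda>(x, y, t). L x y t) \<in> borel_measurable (restrict_space borel (UNIV \<times> Y \<times> UNIV)) \<and>
     (\<forall>x. \<forall>y\<in>Y. \<forall>t. 0 \<le> L x y t)"

definition convex_loss :: "real set \<Rightarrow> ('x \<Rightarrow> real \<Rightarrow> real \<Rightarrow> real) \<Rightarrow> bool" where
  "convex_loss Y L \<longleftrightarrow> (\<forall>x. \<forall>y\<in>Y. convex_on UNIV (L x y))"

definition loss_lipschitz_consts :: "real set \<Rightarrow> ('x \<Rightarrow> real \<Rightarrow> real \<Rightarrow> real) \<Rightarrow> real set" where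
  "loss_lipschitz_consts Y L =
     {c. 0 \<le> c \<and> (\<forall>x. \<forall>y\<in>Y. \<forall>t1 t2. \<bar>L x y t1 - L x y t2\<bar> \<le> c * \<bar>t1 - t2\<bar>)}"

definition lipschitz_loss :: "real set \<Rightarrow> ('x \<Rightarrow> real \<Rightarrow> real \<Rightarrow> real) \<Rightarrow> bool" where
  "lipschitz_loss Y L \<longleftrightarrow> loss_lipschitz_consts Y L \<noteq> {}"

text \<open>For a Lipschitz continuous loss the set of constants is closed, so the infimum is attained.\<close>

definition loss_lip :: "real set \<Rightarrow> ('x \<Rightarrow> real \<Rightarrow> real \<Rightarrow> real) \<Rightarrow> real" where
  "loss_lip Y L = Inf (loss_lipschitz_consts Y L)"

definition shifted_loss :: "('x \<Rightarrow> real \<Rightarrow> real \<Rightarrow> real) \<Rightarrow> 'x \<Rightarrow> real \<Rightarrow> real \<Rightarrow> real" where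
  "shifted_loss L x y t = L x y t - L x y 0"

section \<open>Distributions, risks and support vector machines\<close>

text \<open>
  The space of a measure in \<open>borel_prob_measures Y\<close> is \<open>UNIV \<times> Y\<close>, with the Borel
  \<open>\<sigma>\<close>-algebra of the subspace topology.
\<close>

definition borel_prob_measures :: "real set \<Rightarrow> ('x::topological_space \<times> real) measure set" where
  "borel_prob_measures Y =
     {P. prob_space P \<and> sets P = sets (restrict_space borel (UNIV \<times> Y))}"

definition x_marginal :: "('x::topological_space \<times> real) measure \<Rightarrow> 'x measure" where
  "x_marginal P = distr P borel fst"

definition risk ::
  "('x \<Rightarrow> real \<Rightarrow> real \<Rightarrow> real) \<Rightarrow> ('x \<times> real) measure \<Rightarrow> ('x \<Rightarrow> real) \<Rightarrow> real" where
  "risk L P f = (LINT z|P. L (fst z) (snd z) (f (fst z)))"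

definition svm ::
  "('x \<Rightarrow> real \<Rightarrow> real \<Rightarrow> real) \<Rightarrow> ('x \<times> real) measure \<Rightarrow> real \<Rightarrow>
   ('x \<Rightarrow> real) set \<Rightarrow> (('x \<Rightarrow> real) \<Rightarrow> ('x \<Rightarrow> real) \<Rightarrow> real) \<Rightarrow> 'x \<Rightarrow> real" where
  "svm L P lam H ip =
     arg_min_on (\<lambda>f. risk (shifted_loss L) P f + lam * (fspace_norm ip f)\<^sup>2) H"

section \<open>Norms\<close>

text \<open>
  A signed measure on the measurable space \<open>M\<close> is given as a real-valued set function \<open>\<nu>\<close>.
  The library's \<open>partition_on\<close> excludes empty blocks, which contribute nothing to the sum.
\<close>

definition tv_norm :: "'a measure \<Rightarrow> ('a set \<Rightarrow> real) \<Rightarrow> real" where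
  "tv_norm M \<nu> =
     Sup {(\<Sum>E\<in>\<E>. \<bar>\<nu> E\<bar>) | \<E>. finite \<E> \<and> \<E> \<subseteq> sets M \<and> partition_on (space M) \<E>}"

text \<open>Meant for \<open>1 \<le> p < \<infinity>\<close> and \<open>f\<close> measurable with \<open>\<bar>f\<bar> powr p\<close> integrable.\<close>

definition Lp_norm :: "real \<Rightarrow> 'a measure \<Rightarrow> ('a \<Rightarrow> real) \<Rightarrow> real" where
  "Lp_norm p M f = (LINT x|M. \<bar>f x\<bar> powr p) powr (1 / p)"

end

theory Submission
  imports Defs
begin

text \<open>
  Replacing the subgradients of the loss by the difference quotients
  \<open>w(x, y, t) = (L(x, y, t + \<epsilon>) - L(x, y, t)) / \<epsilon>\<close>, which are measurable, bounded by \<open>\<bar>L\<bar>\<^sub>1\<close>,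
  monotone and Lipschitz continuous in \<open>t\<close>, turns the optimality condition into the strongly monotone equation
  \<open>2 \<lambda> f + E\<^sub>P[w(X, Y, f(X)) \<Phi>(X)] = 0\<close> with \<open>\<Phi>(x) = k(\<cdot>, x)\<close>. It has a solution \<open>f\<^sub>\<epsilon>\<close> by the contraction
  principle, and \<open>f\<^sub>\<epsilon>\<close> minimizes the regularized risk up to \<open>2 \<bar>L\<bar>\<^sub>1 \<epsilon>\<close>, so the \<open>f\<^sub>\<epsilon>\<close> converge in \<open>H\<close>
  to the minimizer as \<open>\<epsilon> \<rightarrow> 0\<close>. Such representations with weights \<open>w\<^sub>1\<close> and \<open>w\<^sub>2\<close> for both problems are compared in one step.
  The element \<open>g = - E\<^sub>P\<^sub>1[w\<^sub>1 \<Phi>\<^sub>2] / (2 \<lambda>\<^sub>1)\<close> of \<open>H\<^sub>2\<close> differs from \<open>f\<^sub>1\<close> at \<open>x\<close> by at most a multiple of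
  \<open>\<integral> \<bar>k\<^sub>1 - k\<^sub>2\<bar>(x, \<cdot>) dP\<^sub>1\<close>, and testing the two equations with \<open>g - f\<^sub>2\<close>, where monotonicity of \<open>w\<close> discards
  the term with \<open>f\<^sub>1 - f\<^sub>2\<close>, gives a quadratic inequality for the norm of \<open>g - f\<^sub>2\<close> in \<open>H\<^sub>2\<close>. The resulting
  bound on \<open>\<bar>f\<^sub>1 - f\<^sub>2\<bar>\<close> is pointwise and free of \<open>\<epsilon>\<close>, so it survives the limit and can be integrated.
\<close>

section \<open>Real Hilbert spaces of functions: Cauchy-Schwarz, Riesz representation, zeros of
  strongly monotone maps\<close>

section \<open>Hilbert spaces of functions\<close>

locale function_hilbert_space =
  fixes H :: "('x \<Rightarrow> real) set" and ip :: "('x \<Rightarrow> real) \<Rightarrow> ('x \<Rightarrow> real) \<Rightarrow> real"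
  assumes inner_product_fspace: "inner_product_fspace H ip"
    and complete: "complete_fspace H ip"
begin

abbreviation nrm :: "('x \<Rightarrow> real) \<Rightarrow> real" where
  "nrm \<equiv> fspace_norm ip"

lemma zero_mem [simp]: "(\<lambda>x. 0) \<in> H"
  and add_mem [simp]: "f \<in> H \<Longrightarrow> g \<in> H \<Longrightarrow> (\<lambda>x. f x + g x) \<in> H"
  and scale_mem [simp]: "f \<in> H \<Longrightarrow> (\<lambda>x. c * f x) \<in> H"
  and ip_commute: "f \<in> H \<Longrightarrow> g \<in> H \<Longrightarrow> ip f g = ip g f"
  and ip_add_left: "f \<in> H \<Longrightarrow> g \<in> H \<Longrightarrow> h \<in> H \<Longrightarrow> ip (\<lambda>x. f x + g x) h = ip f h + ip g h"
  and ip_scale_left: "f \<in> H \<Longrightarrow> g \<in> H \<Longrightarrow> ip (\<lambda>x. c * f x) g = c * ip f g"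
  and ip_nonneg: "f \<in> H \<Longrightarrow> 0 \<le> ip f f"
  and ip_eq_zeroD: "f \<in> H \<Longrightarrow> ip f f = 0 \<Longrightarrow> f = (\<lambda>x. 0)"
  using inner_product_fspace unfolding inner_product_fspace_def by blast+

lemma diff_mem [simp]: "f \<in> H \<Longrightarrow> g \<in> H \<Longrightarrow> (\<lambda>x. f x - g x) \<in> H"
  using add_mem[of f "\<lambda>x. (-1) * g x"] scale_mem[of g "-1"] by simp

lemma ip_diff_left:
  assumes "f \<in> H" "g \<in> H" "h \<in> H"
  shows "ip (\<lambda>x. f x - g x) h = ip f h - ip g h"
  using ip_add_left[of f "\<lambda>x. (-1) * g x" h] ip_scale_left[of g h "-1"] scale_mem[of g "-1"] assms
  by simp

lemma ip_add_right: "f \<in> H \<Longrightarrow> g \<in> H \<Longrightarrow> h \<in> H \<Longrightarrow> ip h (\<lambda>x. f x + g x) = ip h f + ip h g"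
  and ip_scale_right: "f \<in> H \<Longrightarrow> h \<in> H \<Longrightarrow> ip h (\<lambda>x. c * f x) = c * ip h f"
  and ip_diff_right: "f \<in> H \<Longrightarrow> g \<in> H \<Longrightarrow> h \<in> H \<Longrightarrow> ip h (\<lambda>x. f x - g x) = ip h f - ip h g"
  by (simp_all add: ip_commute[of h] ip_add_left ip_scale_left ip_diff_left)

lemmas ip_simps = ip_add_left ip_scale_left ip_diff_left ip_add_right ip_scale_right ip_diff_right

lemma ip_zero_left [simp]: "f \<in> H \<Longrightarrow> ip (\<lambda>x. 0) f = 0"
  using ip_scale_left[of f f 0] by simp

lemma nrm_nonneg: "f \<in> H \<Longrightarrow> 0 \<le> nrm f"
  and nrm_square: "f \<in> H \<Longrightarrow> (nrm f)\<^sup>2 = ip f f"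
  by (simp_all add: fspace_norm_def ip_nonneg)

lemma nrm_zero [simp]: "nrm (\<lambda>x. 0) = 0"
  by (simp add: fspace_norm_def)

lemma nrm_eq_zeroD: "f \<in> H \<Longrightarrow> nrm f = 0 \<Longrightarrow> f = (\<lambda>x. 0)"
  using ip_eq_zeroD nrm_square by fastforce

lemma ip_add_scaled:
  assumes "f \<in> H" "g \<in> H"
  shows "ip (\<lambda>x. f x + t * g x) (\<lambda>x. f x + t * g x) = ip f f + 2 * t * ip f g + t\<^sup>2 * ip g g"
  using assms by (simp add: ip_simps ip_commute[of g f] power2_eq_square algebra_simps)

lemma Cauchy_Schwarz:
  assumes "f \<in> H" "g \<in> H"
  shows "\<bar>ip f g\<bar> \<le> nrm f * nrm g"
proof (cases "ip g g = 0")
  case True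
  then have "g = (\<lambda>x. 0)" using assms ip_eq_zeroD by blast
  then show ?thesis using assms by (simp add: ip_commute[of f])
next
  case False
  then have pos: "0 < ip g g" using ip_nonneg[OF assms(2)] by simp
  have "0 \<le> ip (\<lambda>x. f x + (- ip f g / ip g g) * g x) (\<lambda>x. f x + (- ip f g / ip g g) * g x)"
    by (intro ip_nonneg add_mem scale_mem assms)
  also have "\<dots> = ip f f - (ip f g)\<^sup>2 / ip g g"
    using False by (subst ip_add_scaled[OF assms]) (simp add: power2_eq_square field_simps)
  finally have "(ip f g)\<^sup>2 \<le> ip f f * ip g g" using pos by (simp add: field_simps)
  then have "(ip f g)\<^sup>2 \<le> (nrm f * nrm g)\<^sup>2"
    using assms by (simp add: power_mult_distrib nrm_square)
  then show ?thesis
    using assms by (metis abs_le_square_iff abs_of_nonneg mult_nonneg_nonneg nrm_nonneg)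
qed

lemma nrm_add_le:
  assumes "f \<in> H" "g \<in> H"
  shows "nrm (\<lambda>x. f x + g x) \<le> nrm f + nrm g"
proof -
  have "(nrm (\<lambda>x. f x + g x))\<^sup>2 = ip f f + 2 * ip f g + ip g g"
    using ip_add_scaled[OF assms, of 1] nrm_square[of "\<lambda>x. f x + g x"] assms by simp
  also have "\<dots> \<le> (nrm f + nrm g)\<^sup>2"
    using Cauchy_Schwarz[OF assms] assms by (simp add: power2_sum nrm_square abs_le_iff)
  finally show ?thesis
    by (rule power2_le_imp_le) (simp add: nrm_nonneg assms)
qed

lemma nrm_scale: "f \<in> H \<Longrightarrow> nrm (\<lambda>x. c * f x) = \<bar>c\<bar> * nrm f"
  by (simp add: fspace_norm_def ip_simps real_sqrt_mult mult.assoc[symmetric])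

lemma nrm_diff_commute: "f \<in> H \<Longrightarrow> g \<in> H \<Longrightarrow> nrm (\<lambda>x. f x - g x) = nrm (\<lambda>x. g x - f x)"
  using nrm_scale[of "\<lambda>x. f x - g x" "-1"] by simp

lemma nrm_diff_square:
  assumes "f \<in> H" "g \<in> H"
  shows "(nrm (\<lambda>x. f x - g x))\<^sup>2 = (nrm f)\<^sup>2 - 2 * ip f g + (nrm g)\<^sup>2"
  using ip_add_scaled[OF assms, of "-1"] assms by (simp add: nrm_square)

text \<open>Two sequences of approximate minimizers satisfy a bound of this shape: in
  \<open>Riesz_representation\<close> by the parallelogram law, in \<open>minimizer_exists\<close>
  by strong convexity of the objective.\<close>

lemma Cauchy_bound_convergent:
  fixes b :: "nat \<Rightarrow> real"
  assumes u: "\<And>n. u n \<in> H"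
    and small: "\<And>m n. (nrm (\<lambda>x. u m x - u n x))\<^sup>2 \<le> b m + b n" and "b \<longlonglongrightarrow> 0"
  obtains f where "f \<in> H" "(\<lambda>n. nrm (\<lambda>x. u n x - f x)) \<longlonglongrightarrow> 0"
proof -
  have "\<exists>N. \<forall>m\<ge>N. \<forall>n\<ge>N. nrm (\<lambda>x. u m x - u n x) < e" if "e > 0" for e
  proof -
    have "\<forall>\<^sub>F n in sequentially. b n < e\<^sup>2 / 2"
      using order_tendstoD(2)[OF \<open>b \<longlonglongrightarrow> 0\<close>, of "e\<^sup>2 / 2"] that by simp
    then obtain N where N: "\<And>n. n \<ge> N \<Longrightarrow> b n < e\<^sup>2 / 2"
      unfolding eventually_sequentially by blast
    have "nrm (\<lambda>x. u m x - u n x) < e" if "m \<ge> N" "n \<ge> N" for m n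
      using small[of m n] N[OF that(1)] N[OF that(2)] \<open>e > 0\<close>
      by (intro power2_less_imp_less[of _ e]) auto
    then show ?thesis by blast
  qed
  then show ?thesis
    using complete u that unfolding complete_fspace_def by blast
qed

lemma ip_tendsto:
  assumes "\<And>n. u n \<in> H" "f \<in> H" "g \<in> H" "(\<lambda>n. nrm (\<lambda>x. u n x - f x)) \<longlonglongrightarrow> 0"
  shows "(\<lambda>n. ip (u n) g) \<longlonglongrightarrow> ip f g"
proof -
  have "(\<lambda>n. ip (u n) g - ip f g) \<longlonglongrightarrow> 0"
  proof (rule tendsto_rabs_zero_cancel, rule tendsto_sandwich[OF _ _ tendsto_const])
    show "\<forall>\<^sub>F n in sequentially. \<bar>ip (u n) g - ip f g\<bar> \<le> nrm (\<lambda>x. u n x - f x) * nrm g"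
      using Cauchy_Schwarz[OF diff_mem[OF assms(1,2)] assms(3)] assms by (simp add: ip_diff_left)
    show "(\<lambda>n. nrm (\<lambda>x. u n x - f x) * nrm g) \<longlonglongrightarrow> 0"
      using tendsto_mult_left_zero[OF assms(4)] .
  qed auto
  then show ?thesis by (simp add: LIM_zero_iff)
qed

text \<open>A minimizer of \<open>ip f f - 2 * l f\<close> represents \<open>l\<close>. The bound on
  \<open>l\<close> keeps this energy above \<open>- C\<^sup>2\<close>, near-minimizers form a Cauchy
  sequence, and the first variation vanishes at their limit.\<close>

theorem Riesz_representation:
  assumes add: "\<And>f g. f \<in> H \<Longrightarrow> g \<in> H \<Longrightarrow> l (\<lambda>x. f x + g x) = l f + l g"
    and scale: "\<And>f c. f \<in> H \<Longrightarrow> l (\<lambda>x. c * f x) = c * l f"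
    and bound: "\<And>f. f \<in> H \<Longrightarrow> \<bar>l f\<bar> \<le> C * nrm f"
  obtains u where "u \<in> H" "\<And>f. f \<in> H \<Longrightarrow> ip u f = l f"
proof -
  define E where "E f = ip f f - 2 * l f" for f
  define m where "m = Inf (E ` H)"
  have "- C\<^sup>2 \<le> E f" if "f \<in> H" for f
  proof -
    have "0 \<le> (nrm f - C)\<^sup>2" by simp
    also have "\<dots> \<le> E f + C\<^sup>2"
      using bound[OF that] nrm_square[OF that] unfolding E_def
      by (simp add: power2_diff mult.commute abs_le_iff)
    finally show ?thesis by simp
  qed
  then have bdd: "bdd_below (E ` H)" by (meson bdd_belowI2)
  have m_le: "m \<le> E f" if "f \<in> H" for f
    unfolding m_def using bdd that by (rule cINF_lower)
  define b where "b n = inverse (real (Suc n))" for n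
  have b0: "b \<longlonglongrightarrow> 0"
    unfolding b_def by (rule LIMSEQ_inverse_real_of_nat)
  have "\<exists>f\<in>H. E f < m + b n" for n
  proof -
    have "H \<noteq> {}" using zero_mem by blast
    have "Inf (E ` H) < m + b n" by (simp add: m_def b_def)
    with \<open>H \<noteq> {}\<close> show ?thesis using cINF_less_iff[OF _ bdd] by blast
  qed
  then obtain u where uH: "\<And>n. u n \<in> H" and uE: "\<And>n. E (u n) < m + b n"
    by metis
  have "(nrm (\<lambda>x. u i x - u j x))\<^sup>2 \<le> 2 * b i + 2 * b j" for i j
  proof -
    \<comment> \<open>The midpoint has energy at least \<open>m\<close>, so the parallelogram law
      bounds the squared distance by the excess energies of both ends.\<close>
    define w where "w = (\<lambda>x. (1/2) * (u i x + u j x))"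
    have wH: "w \<in> H" unfolding w_def using uH by (intro scale_mem add_mem)
    have "E w = (ip (u i) (u i) + 2 * ip (u i) (u j) + ip (u j) (u j)) / 4 - l (u i) - l (u j)"
      unfolding E_def w_def using uH
      by (simp only: scale add add_mem scale_mem ip_simps ip_commute[of "u j" "u i"]) (simp add: algebra_simps)
    moreover have "(nrm (\<lambda>x. u i x - u j x))\<^sup>2 = ip (u i) (u i) - 2 * ip (u i) (u j) + ip (u j) (u j)"
      using uH by (simp add: nrm_diff_square nrm_square)
    ultimately have "(nrm (\<lambda>x. u i x - u j x))\<^sup>2 = 2 * E (u i) + 2 * E (u j) - 4 * E w"
      by (simp add: E_def[of "u i"] E_def[of "u j"] field_simps)
    also have "\<dots> \<le> 2 * b i + 2 * b j"
      using uE[of i] uE[of j] m_le[OF wH] by simp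
    finally show ?thesis .
  qed
  moreover have "(\<lambda>n. 2 * b n) \<longlonglongrightarrow> 0"
    using tendsto_mult_right_zero[OF b0] .
  ultimately obtain f where f: "f \<in> H" and lim: "(\<lambda>n. nrm (\<lambda>x. u n x - f x)) \<longlonglongrightarrow> 0"
    using Cauchy_bound_convergent[of u "\<lambda>n. 2 * b n"] uH by blast
  have "ip f g = l g" if g: "g \<in> H" for g
  proof -
    \<comment> \<open>The variation is carried out at \<open>u n\<close>, whose energy exceeds
      \<open>m\<close> by less than \<open>b n\<close>; then only \<open>ip (u n) g\<close> has to
      pass to the limit.\<close>
    have *: "0 \<le> 2 * t * (ip f g - l g) + t\<^sup>2 * ip g g" for t
    proof -
      have "- b n \<le> 2 * t * (ip (u n) g - l g) + t\<^sup>2 * ip g g" for n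
      proof -
        have "m \<le> E (\<lambda>x. u n x + t * g x)"
          using m_le uH g by simp
        also have "\<dots> = E (u n) + (2 * t * (ip (u n) g - l g) + t\<^sup>2 * ip g g)"
          unfolding E_def using uH g by (simp only: ip_add_scaled add scale scale_mem) (simp add: algebra_simps)
        finally show ?thesis using uE[of n] by linarith
      qed
      moreover have "(\<lambda>n. 2 * t * (ip (u n) g - l g) + t\<^sup>2 * ip g g)
          \<longlonglongrightarrow> 2 * t * (ip f g - l g) + t\<^sup>2 * ip g g"
        by (intro tendsto_intros ip_tendsto uH f g lim)
      moreover have "(\<lambda>n. - b n) \<longlonglongrightarrow> 0"
        using tendsto_minus[OF b0] by simp
      ultimately show ?thesis
        using LIMSEQ_le by blast
    qed
    show ?thesis
    proof (rule ccontr)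
      assume ne: "ip f g \<noteq> l g"
      define d where "d = ip f g - l g"
      \<comment> \<open>The summand 1 keeps \<open>q\<close> positive even for \<open>g = 0\<close>.
        At \<open>t = - d / q\<close> the quadratic in \<open>t\<close> is negative unless
        \<open>d = 0\<close>.\<close>
      define q where "q = ip g g + 1"
      have "d \<noteq> 0" "q > 0" using ne ip_nonneg[OF g] by (auto simp: d_def q_def)
      have "0 \<le> 2 * (- d / q) * d + (- d / q)\<^sup>2 * (q - 1)"
        using *[of "- d / q"] by (simp add: d_def q_def)
      also have "\<dots> = - (d\<^sup>2 * (q + 1) / q\<^sup>2)"
        using \<open>q > 0\<close> by (simp add: field_simps power2_eq_square)
      also have "\<dots> < 0" using \<open>d \<noteq> 0\<close> \<open>q > 0\<close> by simp
      finally show False by simp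
    qed
  qed
  with f that show ?thesis by blast
qed

text \<open>A \<open>Metric_space\<close> has a nonnegative symmetric distance off the carrier as
  well, where \<open>ip\<close> is arbitrary; hence the value 0 there.\<close>

sublocale metric: Metric_space H "\<lambda>f g. if f \<in> H \<and> g \<in> H then nrm (\<lambda>x. f x - g x) else 0"
proof
  fix f g h assume "f \<in> H" "g \<in> H" "h \<in> H"
  then show "(if f \<in> H \<and> h \<in> H then nrm (\<lambda>x. f x - h x) else 0)
    \<le> (if f \<in> H \<and> g \<in> H then nrm (\<lambda>x. f x - g x) else 0) +
      (if g \<in> H \<and> h \<in> H then nrm (\<lambda>x. g x - h x) else 0)"
    using nrm_add_le[of "\<lambda>x. f x - g x" "\<lambda>x. g x - h x"] by simp
next
  fix f g assume "f \<in> H" "g \<in> H"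
  then show "(if f \<in> H \<and> g \<in> H then nrm (\<lambda>x. f x - g x) else 0) = 0 \<longleftrightarrow> f = g"
    using nrm_eq_zeroD[of "\<lambda>x. f x - g x"] by (auto simp: fun_eq_iff)
next
  fix f g
  show "(if f \<in> H \<and> g \<in> H then nrm (\<lambda>x. f x - g x) else 0)
    = (if g \<in> H \<and> f \<in> H then nrm (\<lambda>x. g x - f x) else 0)"
    by (cases "f \<in> H \<and> g \<in> H") (simp_all add: nrm_diff_commute[of f g])
qed (simp add: nrm_nonneg)

lemma mcomplete: "metric.mcomplete"
  unfolding metric.mcomplete_def
proof (intro allI impI)
  fix u assume "metric.MCauchy u"
  then have u: "\<And>n. u n \<in> H" and
    "\<forall>e>0. \<exists>N. \<forall>m\<ge>N. \<forall>n\<ge>N. nrm (\<lambda>x. u m x - u n x) < e"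
    unfolding metric.MCauchy_def by (auto simp: image_subset_iff)
  then obtain f where "f \<in> H" "(\<lambda>n. nrm (\<lambda>x. u n x - f x)) \<longlonglongrightarrow> 0"
    using complete unfolding complete_fspace_def by blast
  then have "limitin metric.mtopology u f sequentially"
    using u unfolding metric.limit_metric_sequentially LIMSEQ_def
    by (auto simp: nrm_nonneg)
  then show "\<exists>f. limitin metric.mtopology u f sequentially" by blast
qed

text \<open>Zeros of \<open>A\<close> are the fixed points of the damped step \<open>T\<close>.
  Expanding the square, strong monotonicity controls the cross term and the Lipschitz bound the last
  term, so \<open>T\<close> is a contraction.\<close>

theorem strongly_monotone_zero:
  assumes A: "\<And>f. f \<in> H \<Longrightarrow> A f \<in> H" and "0 < \<mu>" and "\<mu> \<le> M"
    and mono: "\<And>f g. f \<in> H \<Longrightarrow> g \<in> H \<Longrightarrow>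
      \<mu> * (nrm (\<lambda>x. f x - g x))\<^sup>2 \<le> ip (\<lambda>x. A f x - A g x) (\<lambda>x. f x - g x)"
    and lip: "\<And>f g. f \<in> H \<Longrightarrow> g \<in> H \<Longrightarrow> nrm (\<lambda>x. A f x - A g x) \<le> M * nrm (\<lambda>x. f x - g x)"
  obtains f where "f \<in> H" "A f = (\<lambda>x. 0)"
proof -
  \<comment> \<open>This choice minimizes
    \<open>1 - 2 * \<alpha> * \<mu> + \<alpha>\<^sup>2 * M\<^sup>2\<close>, the squared contraction
    factor; the minimum is \<open>q\<^sup>2\<close>.\<close>
  define \<alpha> where "\<alpha> = \<mu> / M\<^sup>2"
  define T where "T f = (\<lambda>x. f x - \<alpha> * A f x)" for f
  define q where "q = sqrt (1 - (\<mu> / M)\<^sup>2)"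
  have "M > 0" "\<alpha> > 0" using assms(2,3) by (auto simp: \<alpha>_def)
  have "(\<mu> / M)\<^sup>2 \<le> 1" "0 < (\<mu> / M)\<^sup>2"
    using assms(2,3) by (auto simp: power_le_one_iff)
  then have q: "0 \<le> q" "q < 1" "q\<^sup>2 = 1 - (\<mu> / M)\<^sup>2" by (auto simp: q_def)
  have TH: "T f \<in> H" if "f \<in> H" for f
    using that A by (simp add: T_def)
  have contr: "nrm (\<lambda>x. T f x - T g x) \<le> q * nrm (\<lambda>x. f x - g x)" if fg: "f \<in> H" "g \<in> H" for f g
  proof -
    let ?d = "\<lambda>x. f x - g x" and ?a = "\<lambda>x. A f x - A g x"
    have mem: "?d \<in> H" "?a \<in> H" using fg A by auto
    have eq: "(\<lambda>x. T f x - T g x) = (\<lambda>x. ?d x + (- \<alpha>) * ?a x)"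
      by (auto simp: T_def algebra_simps)
    have "(nrm (\<lambda>x. T f x - T g x))\<^sup>2 = (nrm ?d)\<^sup>2 - 2 * \<alpha> * ip ?a ?d + \<alpha>\<^sup>2 * (nrm ?a)\<^sup>2"
      unfolding eq using ip_add_scaled[OF mem, of "- \<alpha>"] nrm_square[of "\<lambda>x. ?d x + (- \<alpha>) * ?a x"]
        nrm_square mem ip_commute[OF mem] by simp
    also have "\<dots> \<le> (nrm ?d)\<^sup>2 - 2 * \<alpha> * (\<mu> * (nrm ?d)\<^sup>2) + \<alpha>\<^sup>2 * (M * nrm ?d)\<^sup>2"
      using mono[OF fg] lip[OF fg] nrm_nonneg[OF mem(1)] nrm_nonneg[OF mem(2)] \<open>\<alpha> > 0\<close>
      by (intro add_mono diff_mono mult_left_mono power_mono) auto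
    also have "\<dots> = (q * nrm ?d)\<^sup>2"
      unfolding power_mult_distrib[of q] q(3) using \<open>M > 0\<close>
      by (simp add: \<alpha>_def field_simps power2_eq_square)
    finally show ?thesis
      by (rule power2_le_imp_le) (simp add: q(1) nrm_nonneg[OF mem(1)])
  qed
  obtain f where f: "f \<in> H" "T f = f"
  proof (rule metric.Banach_fixedpoint_thm[OF mcomplete, of T q])
    show "H \<noteq> {}" using zero_mem by blast
    show "T \<in> H \<rightarrow> H" using TH by blast
    show "(if T f \<in> H \<and> T g \<in> H then nrm (\<lambda>x. T f x - T g x) else 0)
      \<le> q * (if f \<in> H \<and> g \<in> H then nrm (\<lambda>x. f x - g x) else 0)" if "f \<in> H" "g \<in> H" for f g
      using contr[OF that] TH that by simp
  qed (use q(2) that in auto)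
  have "A f = (\<lambda>x. 0)"
    using fun_cong[OF f(2)] \<open>\<alpha> > 0\<close> by (auto simp: T_def)
  with f(1) that show ?thesis by blast
qed

end

section \<open>Chord slopes as a smooth substitute for subgradients\<close>

section \<open>Difference quotients of convex functions\<close>

text \<open>The value \<open>h t\<close> is the slope of the chord over
  \<open>[t, t + \<epsilon>]\<close>. Increments of a convex function over a fixed length grow,
  which gives monotonicity. The line through the chord lies below \<open>\<phi>\<close> outside that
  interval; inside it, \<open>h t * (s - t)\<close> and \<open>\<phi> t - \<phi> s\<close> are each
  at most \<open>c * \<epsilon>\<close>, whence the defect
  \<open>2 * c * \<epsilon>\<close>.\<close>

lemma
  fixes \<phi> :: "real \<Rightarrow> real"
  assumes conv: "convex_on UNIV \<phi>" and lip: "\<And>s t. \<bar>\<phi> s - \<phi> t\<bar> \<le> c * \<bar>s - t\<bar>" and "0 < \<epsilon>"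
  defines "h \<equiv> (\<lambda>t. (\<phi> (t + \<epsilon>) - \<phi> t) / \<epsilon>)"
  shows difference_quotient_bound: "\<bar>h t\<bar> \<le> c"
    and difference_quotient_lipschitz: "\<bar>h s - h t\<bar> \<le> 2 * c / \<epsilon> * \<bar>s - t\<bar>"
    and difference_quotient_mono: "mono h"
    and difference_quotient_support: "\<phi> t + h t * (s - t) - 2 * c * \<epsilon> \<le> \<phi> s"
proof -
  show bound: "\<bar>h t\<bar> \<le> c" for t
    using lip[of "t + \<epsilon>" t] \<open>0 < \<epsilon>\<close> by (simp add: h_def field_simps)
  have "\<bar>h s - h t\<bar> = \<bar>(\<phi> (s + \<epsilon>) - \<phi> (t + \<epsilon>)) - (\<phi> s - \<phi> t)\<bar> / \<epsilon>"
    using \<open>0 < \<epsilon>\<close> by (simp add: h_def abs_divide algebra_simps flip: diff_divide_distrib)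
  also have "\<dots> \<le> (c * \<bar>s - t\<bar> + c * \<bar>s - t\<bar>) / \<epsilon>"
    using lip[of "s + \<epsilon>" "t + \<epsilon>"] lip[of s t] \<open>0 < \<epsilon>\<close> by (intro divide_right_mono) auto
  finally show "\<bar>h s - h t\<bar> \<le> 2 * c / \<epsilon> * \<bar>s - t\<bar>" by simp
  show "mono h"
  proof
    fix t s :: real assume "t \<le> s"
    \<comment> \<open>Both \<open>t + \<epsilon>\<close> and \<open>s\<close> are convex
      combinations of \<open>t\<close> and \<open>s + \<epsilon>\<close>, with the two weights
      exchanged; adding the two convexity inequalities cancels \<open>\<theta>\<close>.\<close>
    define \<theta> where "\<theta> = \<epsilon> / (s - t + \<epsilon>)"
    have \<theta>: "0 \<le> \<theta>" "\<theta> \<le> 1" using \<open>t \<le> s\<close> \<open>0 < \<epsilon>\<close> by (auto simp: \<theta>_def)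
    have \<theta>_eq: "\<theta> * (s - t + \<epsilon>) = \<epsilon>" using \<open>t \<le> s\<close> \<open>0 < \<epsilon>\<close> by (simp add: \<theta>_def)
    have pt: "(1 - \<theta>) * t + \<theta> * (s + \<epsilon>) = t + \<epsilon>" "(1 - (1 - \<theta>)) * t + (1 - \<theta>) * (s + \<epsilon>) = s"
      using \<theta>_eq by (simp_all add: algebra_simps)
    have "\<phi> (t + \<epsilon>) \<le> (1 - \<theta>) * \<phi> t + \<theta> * \<phi> (s + \<epsilon>)"
      using convex_onD[OF conv \<theta>, of t "s + \<epsilon>"] by (simp add: pt)
    moreover have "\<phi> s \<le> (1 - (1 - \<theta>)) * \<phi> t + (1 - \<theta>) * \<phi> (s + \<epsilon>)"
      using convex_onD[OF conv, of "1 - \<theta>" t "s + \<epsilon>"] \<theta> pt by simp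
    ultimately have "\<phi> (t + \<epsilon>) + \<phi> s \<le> \<phi> t + \<phi> (s + \<epsilon>)" by (simp add: algebra_simps)
    then show "h t \<le> h s" using \<open>0 < \<epsilon>\<close> by (simp add: h_def divide_right_mono)
  qed
  have "0 \<le> c * \<epsilon>" using bound[of 0] \<open>0 < \<epsilon>\<close> by simp
  show "\<phi> t + h t * (s - t) - 2 * c * \<epsilon> \<le> \<phi> s"
  proof -
    consider "s < t" | "t \<le> s" "s \<le> t + \<epsilon>" | "t + \<epsilon> < s" by linarith
    then have "h t * (s - t) - 2 * c * \<epsilon> \<le> \<phi> s - \<phi> t"
    proof cases
      case 1
      have "(\<phi> s - \<phi> t) / (s - t) \<le> (\<phi> s - \<phi> (t + \<epsilon>)) / (s - (t + \<epsilon>))"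
        "(\<phi> s - \<phi> (t + \<epsilon>)) / (s - (t + \<epsilon>)) \<le> (\<phi> t - \<phi> (t + \<epsilon>)) / (t - (t + \<epsilon>))"
        using convex_on_slope_le[OF conv, of s "t + \<epsilon>" t] 1 \<open>0 < \<epsilon>\<close> by simp_all
      moreover have "(\<phi> t - \<phi> (t + \<epsilon>)) / (t - (t + \<epsilon>)) = h t"
        using \<open>0 < \<epsilon>\<close> by (simp add: h_def field_simps)
      ultimately have "(\<phi> s - \<phi> t) / (s - t) \<le> h t" by simp
      then have "h t * (s - t) \<le> \<phi> s - \<phi> t"
        using 1 by (simp add: neg_divide_le_eq)
      then show ?thesis using \<open>0 \<le> c * \<epsilon>\<close> by simp
    next
      case 2
      have "h t * (s - t) \<le> c * \<epsilon>"
        using bound[of t] 2 \<open>0 < \<epsilon>\<close> by (intro mult_mono) auto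
      moreover have "c * \<bar>s - t\<bar> \<le> c * \<epsilon>"
        using bound[of t] 2 by (intro mult_left_mono) auto
      ultimately show ?thesis using lip[of s t] by linarith
    next
      case 3
      have "(\<phi> t - \<phi> (t + \<epsilon>)) / (t - (t + \<epsilon>)) \<le> (\<phi> t - \<phi> s) / (t - s)"
        using convex_on_slope_le(1)[OF conv, of t s "t + \<epsilon>"] 3 \<open>0 < \<epsilon>\<close> by simp
      moreover have "(\<phi> t - \<phi> (t + \<epsilon>)) / (t - (t + \<epsilon>)) = h t" "(\<phi> t - \<phi> s) / (t - s) = (\<phi> s - \<phi> t) / (s - t)"
        using 3 \<open>0 < \<epsilon>\<close> by (simp_all add: h_def field_simps)
      ultimately have "h t \<le> (\<phi> s - \<phi> t) / (s - t)" by (simp only:)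
      then have "h t * (s - t) \<le> \<phi> s - \<phi> t"
        using 3 \<open>0 < \<epsilon>\<close> by (simp add: pos_le_divide_eq)
      then show ?thesis using \<open>0 \<le> c * \<epsilon>\<close> by simp
    qed
    then show ?thesis by simp
  qed
qed

section \<open>Integrals of bounded functions against a difference of probability measures\<close>

section \<open>Total variation\<close>

lemma sum_le_tv_norm:
  assumes "finite_measure P1" "finite_measure P2" and sets: "sets P1 = sets N" "sets P2 = sets N"
    and part: "finite \<E>" "\<E> \<subseteq> sets N" "partition_on (space N) \<E>"
  shows "(\<Sum>E\<in>\<E>. \<bar>measure P1 E - measure P2 E\<bar>) \<le> tv_norm N (\<lambda>E. measure P1 E - measure P2 E)"
proof -
  interpret P1: finite_measure P1 by fact
  interpret P2: finite_measure P2 by fact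
  \<comment> \<open>A real \<open>Sup\<close> dominates its members only if the set is bounded
    above; the two total masses provide the bound.\<close>
  have "(\<Sum>E\<in>\<F>. \<bar>measure P1 E - measure P2 E\<bar>) \<le> measure P1 (space N) + measure P2 (space N)"
    if "finite \<F>" "\<F> \<subseteq> sets N" "partition_on (space N) \<F>" for \<F>
  proof -
    have "(\<Sum>E\<in>\<F>. \<bar>measure P1 E - measure P2 E\<bar>) \<le> (\<Sum>E\<in>\<F>. measure P1 E + measure P2 E)"
      by (intro sum_mono) (smt (verit) measure_nonneg)
    also have "\<dots> = measure P1 (\<Union>\<F>) + measure P2 (\<Union>\<F>)"
      using that P1.finite_measure_finite_Union[of \<F> "\<lambda>E. E"] P2.finite_measure_finite_Union[of \<F> "\<lambda>E. E"]
      by (simp add: sum.distrib sets partition_on_def disjoint_family_on_def disjoint_def)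
    finally show ?thesis using that by (simp add: partition_on_def)
  qed
  then have "bdd_above {(\<Sum>E\<in>\<F>. \<bar>measure P1 E - measure P2 E\<bar>) |\<F>.
      finite \<F> \<and> \<F> \<subseteq> sets N \<and> partition_on (space N) \<F>}"
    by (intro bdd_aboveI[of _ "measure P1 (space N) + measure P2 (space N)"]) auto
  then show ?thesis
    unfolding tv_norm_def using part by (intro cSup_upper) auto
qed

lemma tv_norm_nonneg:
  assumes "finite_measure P1" "finite_measure P2" "sets P1 = sets N" "sets P2 = sets N"
  shows "0 \<le> tv_norm N (\<lambda>E. measure P1 E - measure P2 E)"
\<comment> \<open>The one-block partition is admissible only if its block is nonempty; the empty
  space has the empty partition.\<close>
proof (cases "space N = {}")
  case True
  then show ?thesis
    using sum_le_tv_norm[OF assms, of "{}"] by (simp add: partition_on_def)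
next
  case False
  then have "(\<Sum>E\<in>{space N}. \<bar>measure P1 E - measure P2 E\<bar>) \<le> tv_norm N (\<lambda>E. measure P1 E - measure P2 E)"
    by (intro sum_le_tv_norm[OF assms]) (auto simp: partition_on_def)
  then show ?thesis by simp
qed

lemma tv_norm_minus: "tv_norm N (\<lambda>E. measure P1 E - measure P2 E) = tv_norm N (\<lambda>E. measure P2 E - measure P1 E)"
  unfolding tv_norm_def by (simp add: abs_minus_commute)

text \<open>Rounding \<open>\<phi>\<close> down to multiples of a small number gives a simple
  function whose level sets form a finite measurable partition, so its two integrals differ by at
  most its maximal modulus times the sum that defines the norm.\<close>

lemma integral_diff_le_tv_norm:
  fixes \<phi> :: "'a \<Rightarrow> real"
  assumes P: "prob_space P1" "prob_space P2" and sets: "sets P1 = sets N" "sets P2 = sets N"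
    and meas: "\<phi> \<in> borel_measurable N" and bound: "\<And>z. z \<in> space N \<Longrightarrow> \<bar>\<phi> z\<bar> \<le> S" and "0 \<le> S"
  shows "\<bar>(LINT z|P1. \<phi> z) - (LINT z|P2. \<phi> z)\<bar> \<le> S * tv_norm N (\<lambda>E. measure P1 E - measure P2 E)"
    (is "?d \<le> S * ?tv")
proof -
  interpret P1: prob_space P1 by fact
  interpret P2: prob_space P2 by fact
  have fin: "finite_measure P1" "finite_measure P2" by unfold_locales
  have sp: "space P1 = space N" "space P2 = space N" using sets[THEN sets_eq_imp_space_eq] .
  have tv0: "0 \<le> ?tv" using tv_norm_nonneg[OF fin sets] .
  \<comment> \<open>The extra \<open>\<epsilon> * ?tv\<close> arises because rounded values reach
    modulus \<open>S + \<epsilon>\<close>; the extra \<open>2 * \<epsilon>\<close> is the rounding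
    error under each of the two measures.\<close>
  have approx: "?d \<le> S * ?tv + \<epsilon> * (?tv + 2)" if "0 < \<epsilon>" for \<epsilon>
  proof -
    define I where "I = {\<lfloor>- S / \<epsilon>\<rfloor>..\<lfloor>S / \<epsilon>\<rfloor>}"
    define E where "E i = {z \<in> space N. \<lfloor>\<phi> z / \<epsilon>\<rfloor> = i}" for i
    define \<psi> where "\<psi> z = (\<Sum>i\<in>I. (of_int i * \<epsilon>) * indicator (E i) z)" for z
    have finI: "finite I" by (simp add: I_def)
    have EN: "E i \<in> sets N" for i
      unfolding E_def using meas by measurable
    have inI: "\<lfloor>\<phi> z / \<epsilon>\<rfloor> \<in> I" if "z \<in> space N" for z
    proof -
      have "- S / \<epsilon> \<le> \<phi> z / \<epsilon>" "\<phi> z / \<epsilon> \<le> S / \<epsilon>"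
        using divide_right_mono[of "- S" "\<phi> z" \<epsilon>] divide_right_mono[of "\<phi> z" S \<epsilon>] bound[OF that] \<open>0 < \<epsilon>\<close>
        by auto
      then show ?thesis by (auto simp: I_def intro!: floor_mono)
    qed
    have \<psi>_eq: "\<psi> z = of_int \<lfloor>\<phi> z / \<epsilon>\<rfloor> * \<epsilon>" if "z \<in> space N" for z
    proof -
      have "\<psi> z = (\<Sum>i\<in>I. if i = \<lfloor>\<phi> z / \<epsilon>\<rfloor> then of_int i * \<epsilon> else 0)"
        unfolding \<psi>_def using that by (intro sum.cong) (auto simp: E_def)
      then show ?thesis using inI[OF that] finI by simp
    qed
    have close: "\<bar>\<phi> z - \<psi> z\<bar> \<le> \<epsilon>" if "z \<in> space N" for z
    proof -
      have "of_int \<lfloor>\<phi> z / \<epsilon>\<rfloor> * \<epsilon> \<le> \<phi> z" "\<phi> z \<le> (of_int \<lfloor>\<phi> z / \<epsilon>\<rfloor> + 1) * \<epsilon>"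
        using mult_right_mono[OF of_int_floor_le[of "\<phi> z / \<epsilon>"], of \<epsilon>]
          mult_right_mono[OF real_of_int_floor_add_one_ge[of "\<phi> z / \<epsilon>"], of \<epsilon>] \<open>0 < \<epsilon>\<close>
        by simp_all
      then show ?thesis unfolding \<psi>_eq[OF that] by (simp add: algebra_simps)
    qed
    have int: "\<bar>(LINT z|P. \<phi> z) - (\<Sum>i\<in>I. of_int i * \<epsilon> * measure P (E i))\<bar> \<le> \<epsilon>"
      if "prob_space P" and setsP: "sets P = sets N" for P
    proof -
      interpret prob_space P by fact
      have spP: "space P = space N" using sets_eq_imp_space_eq[OF setsP] .
      have E: "E i \<in> sets P" for i using EN setsP by simp
      have \<phi>: "integrable P \<phi>"
        using bound meas measurable_cong_sets[OF setsP refl]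
        by (intro integrable_const_bound[of _ S]) (auto simp: spP)
      have \<psi>: "integrable P \<psi>"
        unfolding \<psi>_def using E
        by (intro Bochner_Integration.integrable_sum integrable_mult_right) (simp add: emeasure_finite less_top[symmetric])
      have "(LINT z|P. \<psi> z) = (\<Sum>i\<in>I. of_int i * \<epsilon> * measure P (E i))"
        unfolding \<psi>_def using E
        by (subst Bochner_Integration.integral_sum)
          (auto simp: emeasure_finite less_top[symmetric] sets.Int_space_eq2)
      moreover have "\<bar>(LINT z|P. \<phi> z) - (LINT z|P. \<psi> z)\<bar> \<le> \<epsilon>"
      proof -
        have "\<bar>LINT z|P. (\<phi> z - \<psi> z)\<bar> \<le> (LINT z|P. \<bar>\<phi> z - \<psi> z\<bar>)"
          by (rule integral_abs_bound)
        also have "\<dots> \<le> (LINT z|P. \<epsilon>)"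
          using close \<phi> \<psi> by (intro integral_mono) (auto simp: spP)
        finally show ?thesis using \<phi> \<psi> by (simp add: prob_space)
      qed
      ultimately show ?thesis by simp
    qed
    \<comment> \<open>Discarding empty level sets makes \<open>E\<close> injective and its image a
      partition without empty blocks; they contribute 0 to the sum.\<close>
    define J where "J = {i \<in> I. E i \<noteq> {}}"
    have "(\<Sum>i\<in>I. \<bar>measure P1 (E i) - measure P2 (E i)\<bar>) = (\<Sum>i\<in>J. \<bar>measure P1 (E i) - measure P2 (E i)\<bar>)"
      unfolding J_def using finI by (intro sum.mono_neutral_right) auto
    also have "\<dots> = (\<Sum>A\<in>E ` J. \<bar>measure P1 A - measure P2 A\<bar>)"
    proof (subst sum.reindex)
      show "inj_on E J"
        by (rule inj_onI) (auto simp: J_def E_def)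
    qed simp
    also have "\<dots> \<le> ?tv"
    proof (rule sum_le_tv_norm[OF fin sets])
      show "partition_on (space N) (E ` J)"
        using inI by (auto simp: partition_on_def J_def disjoint_def E_def)
    qed (use finI EN in \<open>auto simp: J_def\<close>)
    finally have tv: "(\<Sum>i\<in>I. \<bar>measure P1 (E i) - measure P2 (E i)\<bar>) \<le> ?tv" .
    have "\<bar>(\<Sum>i\<in>I. of_int i * \<epsilon> * measure P1 (E i)) - (\<Sum>i\<in>I. of_int i * \<epsilon> * measure P2 (E i))\<bar>
      = \<bar>\<Sum>i\<in>I. of_int i * \<epsilon> * (measure P1 (E i) - measure P2 (E i))\<bar>"
      by (simp add: sum_subtractf right_diff_distrib)
    also have "\<dots> \<le> (\<Sum>i\<in>I. \<bar>of_int i * \<epsilon> * (measure P1 (E i) - measure P2 (E i))\<bar>)"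
      by (rule sum_abs)
    also have "\<dots> \<le> (\<Sum>i\<in>I. (S + \<epsilon>) * \<bar>measure P1 (E i) - measure P2 (E i)\<bar>)"
    proof (rule sum_mono)
      fix i assume "i \<in> I"
      \<comment> \<open>The lowest index is a floor and can lie up to 1 below
        \<open>- S / \<epsilon>\<close>.\<close>
      then have "- S / \<epsilon> - 1 \<le> of_int i" "of_int i \<le> S / \<epsilon>"
        unfolding I_def by (auto simp: floor_le_iff le_floor_iff)
      then have "\<bar>of_int i * \<epsilon>\<bar> \<le> S + \<epsilon>"
        using \<open>0 < \<epsilon>\<close> by (auto simp: field_simps abs_le_iff)
      then show "\<bar>of_int i * \<epsilon> * (measure P1 (E i) - measure P2 (E i))\<bar>
        \<le> (S + \<epsilon>) * \<bar>measure P1 (E i) - measure P2 (E i)\<bar>"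
        unfolding abs_mult[of "of_int i * \<epsilon>"] by (rule mult_right_mono) simp
    qed
    also have "\<dots> \<le> (S + \<epsilon>) * ?tv"
      unfolding sum_distrib_left[symmetric] using tv \<open>0 \<le> S\<close> \<open>0 < \<epsilon>\<close> by (intro mult_left_mono) auto
    finally show ?thesis
      using int[OF P(1) sets(1)] int[OF P(2) sets(2)] by (simp add: algebra_simps)
  qed
  show ?thesis
  proof (rule field_le_epsilon)
    fix e :: real assume "0 < e"
    then show "?d \<le> S * ?tv + e"
      using approx[of "e / (?tv + 2)"] tv0 by simp
  qed
qed

section \<open>Convexity of powers, Jensen and Minkowski inequalities for bounded functions\<close>

section \<open>The \<open>L\<^sub>p\<close> norms\<close>

text \<open>For \<open>t = 0\<close> the claim reduces to \<open>(1 - p) * s powr p \<le> 0\<close>;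
  otherwise it is the supporting line of a convex function on the positive half-line. It yields both
  the convexity up to the boundary point 0 and Jensen's inequality below.\<close>

lemma powr_above_tangent:
  fixes s t p :: real
  assumes "1 \<le> p" "0 < s" "0 \<le> t"
  shows "s powr p + p * s powr (p - 1) * (t - s) \<le> t powr p"
proof (cases "t = 0")
  case True
  have "s powr (p - 1) * s = s powr p" using assms by (simp add: powr_diff)
  moreover have "1 * s powr p \<le> p * s powr p" using assms by (intro mult_right_mono) auto
  ultimately show ?thesis using True by (simp add: mult.assoc)
next
  case False
  have "t powr p - s powr p \<ge> p * s powr (p - 1) * (t - s)"
  proof (rule convex_on_imp_above_tangent[OF powr_convex[OF \<open>1 \<le> p\<close>]])
    show "((\<lambda>x. x powr p) has_real_derivative p * s powr (p - 1)) (at s within {0<..})"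
      using assms by (auto intro!: derivative_eq_intros)
  qed (use assms False in \<open>auto simp: interior_open\<close>)
  then show ?thesis by simp
qed

text \<open>The tangent inequality at the mean \<open>w\<close> is averaged over \<open>x\<close>
  and \<open>y\<close>, where its linear terms cancel.\<close>

lemma powr_convex_combination:
  fixes x y p :: real
  assumes "1 \<le> p" "0 \<le> x" "0 \<le> y" "0 \<le> \<theta>" "\<theta> \<le> 1"
  shows "(\<theta> * x + (1 - \<theta>) * y) powr p \<le> \<theta> * x powr p + (1 - \<theta>) * y powr p"
proof -
  define w where "w = \<theta> * x + (1 - \<theta>) * y"
  have "0 \<le> w" using assms by (simp add: w_def)
  show ?thesis
  proof (cases "w = 0")
    case True
    then show ?thesis using assms by (simp add: w_def[symmetric])
  next
    case False
    with \<open>0 \<le> w\<close> have "0 < w" by simp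
    define d where "d = p * w powr (p - 1)"
    have "w powr p = \<theta> * (w powr p + d * (x - w)) + (1 - \<theta>) * (w powr p + d * (y - w))"
      by (simp add: w_def algebra_simps)
    also have "\<dots> \<le> \<theta> * x powr p + (1 - \<theta>) * y powr p"
      unfolding d_def using assms \<open>0 < w\<close> by (intro add_mono mult_left_mono powr_above_tangent) auto
    finally show ?thesis by (simp only: w_def)
  qed
qed

lemma (in prob_space) integrable_powr_bounded:
  fixes X :: "'a \<Rightarrow> real"
  assumes "X \<in> borel_measurable M" "\<And>x. x \<in> space M \<Longrightarrow> \<bar>X x\<bar> \<le> K" "1 \<le> p"
  shows "integrable M (\<lambda>x. \<bar>X x\<bar> powr p)"
  using assms by (intro integrable_const_bound[of _ "K powr p"]) (auto intro!: powr_mono2)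

text \<open>Jensen's inequality: the tangent at the mean is integrated, and its linear part has
  expectation 0.\<close>

lemma (in prob_space) expectation_powr_le:
  fixes X :: "'a \<Rightarrow> real"
  assumes [measurable]: "X \<in> borel_measurable M" and bound: "\<And>x. x \<in> space M \<Longrightarrow> 0 \<le> X x \<and> X x \<le> K"
    and "1 \<le> p"
  shows "expectation X powr p \<le> expectation (\<lambda>x. X x powr p)"
proof -
  have X: "integrable M X"
    using bound by (intro integrable_const_bound[of _ K]) auto
  have Xp: "integrable M (\<lambda>x. X x powr p)"
    using bound \<open>1 \<le> p\<close> by (intro integrable_const_bound[of _ "K powr p"]) (auto intro!: powr_mono2)
  define m where "m = expectation X"
  have "0 \<le> m" unfolding m_def using bound by (intro integral_nonneg_AE) auto
  show ?thesis
  proof (cases "m = 0")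
    case True
    then show ?thesis by (simp add: m_def[symmetric])
  next
    case False
    have "m powr p = expectation (\<lambda>x. m powr p + p * m powr (p - 1) * (X x - m))"
      using X by (simp add: m_def prob_space)
    also have "\<dots> \<le> expectation (\<lambda>x. X x powr p)"
      using bound X Xp False \<open>0 \<le> m\<close> \<open>1 \<le> p\<close> by (intro integral_mono powr_above_tangent) auto
    finally show ?thesis by (simp only: m_def)
  qed
qed

lemma Lp_norm_nonneg: "0 \<le> Lp_norm p M f"
  by (simp add: Lp_norm_def)

lemma Lp_norm_scale:
  assumes "1 \<le> p"
  shows "Lp_norm p M (\<lambda>x. c * f x) = \<bar>c\<bar> * Lp_norm p M f"
  using assms by (simp add: Lp_norm_def abs_mult powr_mult powr_powr integral_nonneg_AE)

lemma Lp_norm_powr: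
  assumes "1 \<le> p"
  shows "Lp_norm p M f powr p = (LINT x|M. \<bar>f x\<bar> powr p)"
  using assms by (simp add: Lp_norm_def powr_powr integral_nonneg_AE)

lemma Lp_norm_leI:
  assumes "1 \<le> p" "0 \<le> r" "(LINT x|M. \<bar>f x\<bar> powr p) \<le> r powr p"
  shows "Lp_norm p M f \<le> r"
proof -
  have "Lp_norm p M f \<le> (r powr p) powr (1 / p)"
    unfolding Lp_norm_def using assms by (intro powr_mono2) (auto intro!: integral_nonneg_AE)
  then show ?thesis using assms by (simp add: powr_powr)
qed

text \<open>Minkowski's inequality with a constant as second function. After scaling by
  \<open>a + b\<close>, the sum \<open>g + b\<close> is a convex combination of \<open>g / a\<close>
  and 1, both of norm at most 1, and convexity of the power applies pointwise.\<close>

lemma (in prob_space) Lp_norm_le_add_const: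
  fixes f g :: "'a \<Rightarrow> real"
  assumes p: "1 \<le> p" and [measurable]: "f \<in> borel_measurable M" "g \<in> borel_measurable M"
    and g: "\<And>x. x \<in> space M \<Longrightarrow> 0 \<le> g x \<and> g x \<le> K"
    and f: "\<And>x. x \<in> space M \<Longrightarrow> \<bar>f x\<bar> \<le> g x + b" and "0 \<le> b"
  shows "Lp_norm p M f \<le> Lp_norm p M g + b"
proof (rule field_le_epsilon)
  fix e :: real assume "0 < e"
  \<comment> \<open>The slack \<open>e\<close> makes \<open>a\<close> positive even when
    \<open>g\<close> vanishes almost everywhere, so that division by \<open>a\<close> is
    sound.\<close>
  define a where "a = Lp_norm p M g + e"
  have "0 < a" using Lp_norm_nonneg[of p M g] \<open>0 < e\<close> by (simp add: a_def)
  define \<theta> where "\<theta> = a / (a + b)"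
  have \<theta>: "0 \<le> \<theta>" "\<theta> \<le> 1" using \<open>0 < a\<close> \<open>0 \<le> b\<close> by (auto simp: \<theta>_def)
  have gp: "integrable M (\<lambda>x. \<bar>g x\<bar> powr p)"
    using g p by (intro integrable_powr_bounded[of _ K]) auto
  have fp: "integrable M (\<lambda>x. \<bar>f x\<bar> powr p)"
  proof (rule integrable_powr_bounded[of _ "K + b"])
    show "\<bar>f x\<bar> \<le> K + b" if "x \<in> space M" for x
      using f[OF that] g[OF that] by linarith
  qed (use p in auto)
  have "(LINT x|M. \<bar>f x\<bar> powr p)
      \<le> (LINT x|M. (a + b) powr p * (\<theta> * (\<bar>g x\<bar> powr p / a powr p) + (1 - \<theta>)))"
  proof (rule integral_mono)
    fix x assume x: "x \<in> space M"
    have eq: "g x + b = (a + b) * (\<theta> * (g x / a) + (1 - \<theta>) * 1)"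
    proof -
      have "(a + b) * \<theta> = a" "(a + b) * (1 - \<theta>) = b"
        using \<open>0 < a\<close> \<open>0 \<le> b\<close> by (simp_all add: \<theta>_def right_diff_distrib)
      then have "(a + b) * (\<theta> * (g x / a) + (1 - \<theta>) * 1) = a * (g x / a) + b"
        by (simp only: distrib_left mult.assoc[symmetric] mult_1_right)
      then show ?thesis using \<open>0 < a\<close> by simp
    qed
    have "\<bar>f x\<bar> powr p \<le> (g x + b) powr p"
      using f[OF x] p by (intro powr_mono2) auto
    also have "\<dots> = (a + b) powr p * (\<theta> * (g x / a) + (1 - \<theta>) * 1) powr p"
      unfolding eq using g[OF x] \<theta> \<open>0 < a\<close> \<open>0 \<le> b\<close> by (intro powr_mult)
    also have "\<dots> \<le> (a + b) powr p * (\<theta> * (g x / a) powr p + (1 - \<theta>) * 1 powr p)"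
      using g[OF x] \<theta> \<open>0 < a\<close> p by (intro mult_left_mono powr_convex_combination) auto
    finally show "\<bar>f x\<bar> powr p \<le> (a + b) powr p * (\<theta> * (\<bar>g x\<bar> powr p / a powr p) + (1 - \<theta>))"
      using g[OF x] \<open>0 < a\<close> by (simp add: powr_divide)
  qed (use fp gp in auto)
  also have "\<dots> = (a + b) powr p * (\<theta> * ((LINT x|M. \<bar>g x\<bar> powr p) / a powr p) + (1 - \<theta>))"
    using gp by (simp add: prob_space)
  also have "\<dots> \<le> (a + b) powr p * (\<theta> * 1 + (1 - \<theta>))"
  proof -
    have "(LINT x|M. \<bar>g x\<bar> powr p) \<le> a powr p"
      unfolding Lp_norm_powr[OF p, symmetric] a_def using p \<open>0 < e\<close> Lp_norm_nonneg
      by (intro powr_mono2) auto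
    then show ?thesis
      using \<theta> \<open>0 < a\<close> by (intro mult_left_mono add_mono) auto
  qed
  finally show "Lp_norm p M f \<le> Lp_norm p M g + b + e"
    using Lp_norm_leI[OF p, of "a + b" M f] \<open>0 < a\<close> \<open>0 \<le> b\<close> by (simp add: a_def algebra_simps)
qed

lemma (in prob_space) expectation_le_Lp_norm:
  fixes X :: "'a \<Rightarrow> real"
  assumes "X \<in> borel_measurable M" and bound: "\<And>x. x \<in> space M \<Longrightarrow> \<bar>X x\<bar> \<le> K" and p: "1 \<le> p"
  shows "expectation (\<lambda>x. \<bar>X x\<bar>) \<le> Lp_norm p M X"
proof -
  have "expectation (\<lambda>x. \<bar>X x\<bar>) = (expectation (\<lambda>x. \<bar>X x\<bar>) powr p) powr (1 / p)"
    using p by (simp add: powr_powr integral_nonneg_AE)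
  also have "\<dots> \<le> Lp_norm p M X"
    unfolding Lp_norm_def using assms by (intro powr_mono2 expectation_powr_le[of _ K]) auto
  finally show ?thesis .
qed

text \<open>Jensen's inequality for the inner integral, then Fubini. This turns the averaged kernel
  difference into the norm over the product measure.\<close>

lemma (in prob_space) Lp_norm_section_integral_le:
  fixes k :: "'a \<times> 'a \<Rightarrow> real"
  assumes k[measurable]: "k \<in> borel_measurable (M \<Otimes>\<^sub>M M)"
    and bound: "\<And>z. z \<in> space (M \<Otimes>\<^sub>M M) \<Longrightarrow> \<bar>k z\<bar> \<le> K" and p: "1 \<le> p"
  shows "Lp_norm p M (\<lambda>x. LINT y|M. \<bar>k (x, y)\<bar>) \<le> Lp_norm p (M \<Otimes>\<^sub>M M) k"
proof (rule Lp_norm_leI[OF p Lp_norm_nonneg])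
  interpret pair: pair_prob_space M M ..
  have bound': "\<bar>k (x, y)\<bar> \<le> K" if "x \<in> space M" "y \<in> space M" for x y
    using bound that by (simp add: space_pair_measure)
  have int: "integrable (M \<Otimes>\<^sub>M M) (\<lambda>z. \<bar>k z\<bar> powr p)"
    using bound p by (intro pair.P.integrable_powr_bounded) auto
  have K: "(LINT y|M. \<bar>k (x, y)\<bar>) \<le> K" if "x \<in> space M" for x
    using that bound' by (intro integral_le_const integrable_const_bound[of _ K]) auto
  have "(LINT x|M. \<bar>LINT y|M. \<bar>k (x, y)\<bar>\<bar> powr p) \<le> (LINT x|M. LINT y|M. \<bar>k (x, y)\<bar> powr p)"
  proof (rule integral_mono)
    show "integrable M (\<lambda>x. \<bar>LINT y|M. \<bar>k (x, y)\<bar>\<bar> powr p)"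
      using K p by (intro integrable_powr_bounded[of _ K]) (auto simp: integral_nonneg_AE)
    show "integrable M (\<lambda>x. LINT y|M. \<bar>k (x, y)\<bar> powr p)"
      using pair.integrable_fst'[OF int] by simp
    show "\<bar>LINT y|M. \<bar>k (x, y)\<bar>\<bar> powr p \<le> (LINT y|M. \<bar>k (x, y)\<bar> powr p)" if "x \<in> space M" for x
      using expectation_powr_le[of "\<lambda>y. \<bar>k (x, y)\<bar>" K p] that bound' p by (simp add: integral_nonneg_AE)
  qed
  also have "\<dots> = (LINT z|(M \<Otimes>\<^sub>M M). \<bar>k z\<bar> powr p)"
    using pair.integral_fst'[OF int] by simp
  finally show "(LINT x|M. \<bar>LINT y|M. \<bar>k (x, y)\<bar>\<bar> powr p) \<le> Lp_norm p (M \<Otimes>\<^sub>M M) k powr p"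
    by (simp add: Lp_norm_powr[OF p])
qed

section \<open>Evaluation bounds, measurability and weighted kernel embeddings\<close>

section \<open>Reproducing kernel Hilbert spaces with bounded kernel\<close>

lemma (in prob_space) abs_expectation_le:
  fixes f :: "'a \<Rightarrow> real"
  assumes "\<And>z. z \<in> space M \<Longrightarrow> \<bar>f z\<bar> \<le> b"
  shows "\<bar>expectation f\<bar> \<le> b"
proof (cases "integrable M f")
  case True
  have "\<bar>expectation f\<bar> \<le> expectation (\<lambda>z. \<bar>f z\<bar>)" by (rule integral_abs_bound)
  also have "\<dots> \<le> b" using True assms by (intro integral_le_const) auto
  finally show ?thesis .
next
  \<comment> \<open>A non-integrable function has integral 0 by convention, so
    \<open>0 \<le> b\<close> suffices; it follows from the hypothesis at any point of the nonempty
    space.\<close>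
  case False
  obtain z where "z \<in> space M" using not_empty by blast
  then have "0 \<le> b" using assms[of z] by linarith
  with False show ?thesis by (simp add: not_integrable_integral_eq)
qed

text \<open>Here \<open>\<kappa>\<close> is any upper bound rather than the exact sup norm, so that
  two kernels can share the maximum of theirs.\<close>

locale bounded_rkhs =
  fixes k :: "'x::polish_space \<Rightarrow> 'x \<Rightarrow> real" and H ip and \<kappa> :: real
  assumes rkhs: "is_rkhs k H ip"
    and sqrt_diag_le: "\<And>x. sqrt (k x x) \<le> \<kappa>"
    and measurable_kernel: "case_prod k \<in> borel_measurable borel"
begin

sublocale function_hilbert_space H ip
  using rkhs by unfold_locales (simp_all add: is_rkhs_def)

lemma section_mem [simp]: "(\<lambda>x'. k x' x) \<in> H"
  and reproducing: "f \<in> H \<Longrightarrow> ip f (\<lambda>x'. k x' x) = f x"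
  using rkhs by (simp_all add: is_rkhs_def)

lemma kernel_commute: "k x y = k y x"
  using reproducing[OF section_mem[of y], of x] reproducing[OF section_mem[of x], of y]
    ip_commute[OF section_mem section_mem, of x y] by simp

lemma nrm_section_le: "nrm (\<lambda>x'. k x' x) \<le> \<kappa>"
  using sqrt_diag_le[of x] by (simp add: fspace_norm_def reproducing)

lemma kappa_nonneg: "0 \<le> \<kappa>"
  using nrm_section_le[of undefined] nrm_nonneg[OF section_mem, of undefined] by linarith

lemma abs_le_nrm:
  assumes "f \<in> H"
  shows "\<bar>f x\<bar> \<le> \<kappa> * nrm f"
proof -
  have "\<bar>f x\<bar> \<le> nrm f * nrm (\<lambda>x'. k x' x)"
    using Cauchy_Schwarz[OF assms section_mem, of x] reproducing[OF assms] by simp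
  also have "\<dots> \<le> nrm f * \<kappa>"
    using nrm_section_le nrm_nonneg[OF assms] by (rule mult_left_mono)
  finally show ?thesis by (simp add: mult.commute)
qed

lemma abs_mult_mem_le:
  assumes "g \<in> H" "\<bar>a\<bar> \<le> c"
  shows "\<bar>a * g x\<bar> \<le> c * (\<kappa> * nrm g)"
  unfolding abs_mult using assms abs_le_nrm[of g x] by (intro mult_mono) auto

lemma abs_kernel_le: "\<bar>k x y\<bar> \<le> \<kappa>\<^sup>2"
proof -
  have "\<bar>k x y\<bar> \<le> \<kappa> * nrm (\<lambda>x'. k x' y)" using abs_le_nrm[OF section_mem] .
  also have "\<dots> \<le> \<kappa> * \<kappa>" using nrm_section_le kappa_nonneg by (rule mult_left_mono)
  finally show ?thesis by (simp add: power2_eq_square)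
qed

lemma borel_measurable_section: "(\<lambda>x'. k x' x) \<in> borel_measurable borel"
proof -
  have "(\<lambda>x'. case_prod k (x', x)) \<in> borel_measurable borel"
    by (rule measurable_compose[OF _ measurable_kernel]) measurable
  then show ?thesis by simp
qed

lemma tendsto_pointwise:
  assumes "\<And>n. u n \<in> H" "f \<in> H" "(\<lambda>n. nrm (\<lambda>x. u n x - f x)) \<longlonglongrightarrow> 0"
  shows "(\<lambda>n. u n x) \<longlonglongrightarrow> f x"
  using ip_tendsto[OF assms(1,2) section_mem assms(3), of x] assms by (simp add: reproducing)

text \<open>
  The measurable elements form a Hilbert space in which the functional \<open>ip f\<close> is
  represented by some \<open>g\<close>; both \<open>f\<close> and \<open>g\<close> reproduce against the kernel sections, so \<open>f = g\<close>.
\<close>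

lemma borel_measurable_mem:
  assumes "f \<in> H"
  shows "f \<in> borel_measurable borel"
proof -
  define H' where "H' = {f \<in> H. f \<in> borel_measurable borel}"
  have sub: "f \<in> H" if "f \<in> H'" for f using that by (simp add: H'_def)
  interpret H': function_hilbert_space H' ip
  proof
    show "inner_product_fspace H' ip"
      unfolding inner_product_fspace_def H'_def
      by (auto simp: ip_simps ip_nonneg intro: ip_commute dest: ip_eq_zeroD)
    show "complete_fspace H' ip"
      unfolding complete_fspace_def
    proof (intro allI impI, elim conjE)
      fix u :: "nat \<Rightarrow> 'x \<Rightarrow> real" assume u: "\<forall>n. u n \<in> H'"
        and Cauchy: "\<forall>e>0. \<exists>N. \<forall>m\<ge>N. \<forall>n\<ge>N. nrm (\<lambda>x. u m x - u n x) < e"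
      have uH: "u n \<in> H" for n using u sub by blast
      with Cauchy obtain f where f: "f \<in> H" "(\<lambda>n. nrm (\<lambda>x. u n x - f x)) \<longlonglongrightarrow> 0"
        using complete unfolding complete_fspace_def by blast
      \<comment> \<open>Norm convergence implies pointwise convergence, and pointwise limits stay
        measurable; the subspace is therefore closed.\<close>
      have "f \<in> borel_measurable borel"
      proof (rule borel_measurable_LIMSEQ_real)
        show "(\<lambda>n. u n x) \<longlonglongrightarrow> f x" for x using tendsto_pointwise[OF uH f] .
        show "u n \<in> borel_measurable borel" for n using u by (simp add: H'_def)
      qed
      with f show "\<exists>f\<in>H'. (\<lambda>n. nrm (\<lambda>x. u n x - f x)) \<longlonglongrightarrow> 0"
        by (auto simp: H'_def)
    qed
  qed
  obtain g where g: "g \<in> H'" "\<And>v. v \<in> H' \<Longrightarrow> ip g v = ip f v"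
  proof (rule H'.Riesz_representation[of "ip f" "nrm f"])
    show "\<bar>ip f v\<bar> \<le> nrm f * nrm v" if "v \<in> H'" for v
      using Cauchy_Schwarz[OF assms sub[OF that]] .
  qed (use assms sub in \<open>auto simp: ip_simps\<close>)
  have "g x = f x" for x
  proof -
    have "(\<lambda>x'. k x' x) \<in> H'" using borel_measurable_section by (simp add: H'_def)
    then show ?thesis using g(2)[of "\<lambda>x'. k x' x"] reproducing assms sub[OF g(1)] by simp
  qed
  then have "g = f" by blast
  then show ?thesis using g(1) by (simp add: H'_def)
qed

text \<open>Testing \<open>u\<close> against itself bounds its squared norm by
  \<open>c * \<kappa>\<close> times its norm, and one factor cancels.\<close>

lemma nrm_embedding_le:
  fixes P :: "('x \<times> 'b) measure"
  assumes "prob_space P" "u \<in> H" and w: "\<And>z. z \<in> space P \<Longrightarrow> \<bar>w z\<bar> \<le> c"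
    and u: "ip u u = (LINT z|P. w z * u (fst z))"
  shows "nrm u \<le> c * \<kappa>"
proof -
  interpret prob_space P by fact
  obtain z where "z \<in> space P" using not_empty by blast
  then have "0 \<le> c" using w[of z] by linarith
  have "(nrm u)\<^sup>2 = \<bar>LINT z|P. w z * u (fst z)\<bar>"
    using u nrm_square[OF \<open>u \<in> H\<close>] ip_nonneg[OF \<open>u \<in> H\<close>] by simp
  also have "\<dots> \<le> c * (\<kappa> * nrm u)"
    using w by (intro abs_expectation_le abs_mult_mem_le[OF \<open>u \<in> H\<close>])
  finally have "nrm u * nrm u \<le> (c * \<kappa>) * nrm u" by (simp add: power2_eq_square)
  then show ?thesis
    using nrm_nonneg[OF \<open>u \<in> H\<close>] \<open>0 \<le> c\<close> kappa_nonneg by (cases "nrm u = 0") auto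
qed

text \<open>The element \<open>u\<close> is the weighted mean of the feature map,
  \<open>E\<^sub>P[w \<Phi>(X)]\<close>, obtained weakly from the Riesz theorem instead of as a
  vector-valued integral.\<close>

lemma embedding:
  fixes P :: "('x \<times> 'b) measure"
  assumes "prob_space P" and fst[measurable]: "fst \<in> P \<rightarrow>\<^sub>M borel"
    and w[measurable]: "w \<in> borel_measurable P" and bound: "\<And>z. z \<in> space P \<Longrightarrow> \<bar>w z\<bar> \<le> c"
  obtains u where "u \<in> H" "\<And>g. g \<in> H \<Longrightarrow> ip u g = (LINT z|P. w z * g (fst z))"
proof -
  interpret prob_space P by fact
  have [measurable]: "g \<in> borel_measurable borel" if "g \<in> H" for g
    using borel_measurable_mem[OF that] .
  have b: "\<bar>w z * g (fst z)\<bar> \<le> (c * \<kappa>) * nrm g" if "g \<in> H" "z \<in> space P" for g z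
    using abs_mult_mem_le[OF that(1) bound[OF that(2)]] by (simp add: mult.assoc)
  have int: "integrable P (\<lambda>z. w z * g (fst z))" if "g \<in> H" for g
    using that b by (intro integrable_const_bound[of _ "(c * \<kappa>) * nrm g"]) auto
  show thesis
  proof (rule Riesz_representation[of "\<lambda>g. LINT z|P. w z * g (fst z)" "c * \<kappa>"])
    show "\<bar>LINT z|P. w z * g (fst z)\<bar> \<le> c * \<kappa> * nrm g" if "g \<in> H" for g
      using b that by (intro abs_expectation_le) auto
  qed (use int that in \<open>auto simp: distrib_left mult.left_commute[of "w _"]\<close>)
qed

text \<open>With \<open>G f\<close> the embedding of the weights \<open>h z (f (fst z))\<close>, the
  equation says that \<open>\<mu> f + G f\<close> is zero. Monotone \<open>h\<close> makes
  \<open>G\<close> monotone and Lipschitz \<open>h\<close> makes it Lipschitz, so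
  \<open>strongly_monotone_zero\<close> applies.\<close>

lemma monotone_equation_solvable:
  fixes P :: "('x \<times> 'b) measure" and h :: "'x \<times> 'b \<Rightarrow> real \<Rightarrow> real"
  assumes "prob_space P" and fst[measurable]: "fst \<in> P \<rightarrow>\<^sub>M borel"
    and h: "\<And>f. f \<in> borel_measurable borel \<Longrightarrow> (\<lambda>z. h z (f (fst z))) \<in> borel_measurable P"
    and bound: "\<And>z t. z \<in> space P \<Longrightarrow> \<bar>h z t\<bar> \<le> c"
    and lip: "\<And>z s t. z \<in> space P \<Longrightarrow> \<bar>h z s - h z t\<bar> \<le> K * \<bar>s - t\<bar>"
    and mono: "\<And>z. z \<in> space P \<Longrightarrow> mono (h z)" and "0 < \<mu>" "0 \<le> K"
  obtains f where "f \<in> H" "\<And>g. g \<in> H \<Longrightarrow> \<mu> * ip f g + (LINT z|P. h z (f (fst z)) * g (fst z)) = 0"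
proof -
  interpret prob_space P by fact
  have meas[measurable]: "g \<in> borel_measurable borel" if "g \<in> H" for g
    using borel_measurable_mem[OF that] .
  have hm[measurable]: "(\<lambda>z. h z (f (fst z))) \<in> borel_measurable P" if "f \<in> H" for f
    using h[OF meas[OF that]] .
  have "\<exists>u\<in>H. \<forall>g\<in>H. ip u g = (LINT z|P. h z (f (fst z)) * g (fst z))" if "f \<in> H" for f
    by (rule embedding[OF \<open>prob_space P\<close> fst hm[OF that] bound]) blast+
  then obtain G where GH: "\<And>f. f \<in> H \<Longrightarrow> G f \<in> H" and
    G: "\<And>f g. f \<in> H \<Longrightarrow> g \<in> H \<Longrightarrow> ip (G f) g = (LINT z|P. h z (f (fst z)) * g (fst z))"
    by metis
  have int: "integrable P (\<lambda>z. h z (f (fst z)) * g (fst z))" if "f \<in> H" "g \<in> H" for f g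
    using that abs_mult_mem_le[OF that(2) bound]
    by (intro integrable_const_bound[of _ "c * (\<kappa> * nrm g)"]) auto
  have Gdiff: "ip (\<lambda>x. G f x - G g x) v = (LINT z|P. (h z (f (fst z)) - h z (g (fst z))) * v (fst z))"
    if "f \<in> H" "g \<in> H" "v \<in> H" for f g v
    using that int GH by (simp add: ip_diff_left G left_diff_distrib)
  define A where "A f = (\<lambda>x. \<mu> * f x + G f x)" for f
  have AH: "A f \<in> H" if "f \<in> H" for f using that GH by (simp add: A_def)
  have A_diff: "(\<lambda>x. A f x - A g x) = (\<lambda>x. \<mu> * (f x - g x) + (G f x - G g x))" for f g
    by (auto simp: A_def algebra_simps)
  obtain f where f: "f \<in> H" "A f = (\<lambda>x. 0)"
  \<comment> \<open>One factor \<open>\<kappa>\<close> comes from evaluating \<open>f - g\<close> at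
    a point, the other from the norm of the embedding.\<close>
  proof (rule strongly_monotone_zero[of A \<mu> "\<mu> + K * \<kappa> * \<kappa>"])
    fix f g assume fg: "f \<in> H" "g \<in> H"
    let ?d = "\<lambda>x. f x - g x"
    have mem: "?d \<in> H" "(\<lambda>x. G f x - G g x) \<in> H" using fg GH by auto
    have "0 \<le> ip (\<lambda>x. G f x - G g x) ?d"
      unfolding Gdiff[OF fg mem(1)]
    proof (intro integral_nonneg_AE AE_I2)
      fix z assume "z \<in> space P"
      then show "0 \<le> (h z (f (fst z)) - h z (g (fst z))) * (f (fst z) - g (fst z))"
        using monoD[OF mono, of z "f (fst z)" "g (fst z)"] monoD[OF mono, of z "g (fst z)" "f (fst z)"]
        by (cases "f (fst z) \<le> g (fst z)") (auto simp: zero_le_mult_iff)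
    qed
    then show "\<mu> * (nrm ?d)\<^sup>2 \<le> ip (\<lambda>x. A f x - A g x) ?d"
      unfolding A_diff using mem by (simp add: ip_add_left ip_scale_left nrm_square)
    have "nrm (\<lambda>x. G f x - G g x) \<le> (K * (\<kappa> * nrm ?d)) * \<kappa>"
    proof (rule nrm_embedding_le[OF \<open>prob_space P\<close> mem(2)])
      show "\<bar>h z (f (fst z)) - h z (g (fst z))\<bar> \<le> K * (\<kappa> * nrm ?d)" if "z \<in> space P" for z
        using lip[OF that, of "f (fst z)" "g (fst z)"] mult_left_mono[OF abs_le_nrm[OF mem(1), of "fst z"] \<open>0 \<le> K\<close>]
        by linarith
    qed (rule Gdiff[OF fg mem(2)])
    then show "nrm (\<lambda>x. A f x - A g x) \<le> (\<mu> + K * \<kappa> * \<kappa>) * nrm ?d"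
      unfolding A_diff using nrm_add_le[OF scale_mem[OF mem(1)] mem(2), of \<mu>] nrm_scale[OF mem(1), of \<mu>] \<open>0 < \<mu>\<close>
      by (simp add: algebra_simps)
  qed (use AH \<open>0 < \<mu>\<close> \<open>0 \<le> K\<close> kappa_nonneg in auto)
  have "\<mu> * ip f g + (LINT z|P. h z (f (fst z)) * g (fst z)) = 0" if "g \<in> H" for g
    using arg_cong[OF f(2), of "\<lambda>v. ip v g"] that f(1) GH
    by (simp add: A_def ip_add_left ip_scale_left G)
  with f(1) that show ?thesis by blast
qed

end

section \<open>The smoothed optimality condition and its limit, the minimizer\<close>

section \<open>Support vector machines\<close>

text \<open>Each difference quotient is a lower bound of the set of Lipschitz constants, hence at
  most its infimum.\<close>

lemma abs_loss_diff_le: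
  assumes "lipschitz_loss Y L" "y \<in> Y"
  shows "\<bar>L x y s - L x y t\<bar> \<le> loss_lip Y L * \<bar>s - t\<bar>"
proof (cases "s = t")
  case False
  have "\<bar>L x y s - L x y t\<bar> / \<bar>s - t\<bar> \<le> loss_lip Y L"
    unfolding loss_lip_def
  proof (rule cInf_greatest)
    show "loss_lipschitz_consts Y L \<noteq> {}" using assms by (simp add: lipschitz_loss_def)
    show "\<bar>L x y s - L x y t\<bar> / \<bar>s - t\<bar> \<le> c" if "c \<in> loss_lipschitz_consts Y L" for c
      using that assms(2) False by (auto simp: loss_lipschitz_consts_def divide_le_eq)
  qed
  then show ?thesis using False by (simp add: divide_le_eq)
qed simp

lemma loss_lip_nonneg:
  assumes "lipschitz_loss Y L"
  shows "0 \<le> loss_lip Y L"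
  unfolding loss_lip_def using assms
  by (intro cInf_greatest) (auto simp: lipschitz_loss_def loss_lipschitz_consts_def)

locale svm_problem = bounded_rkhs k H ip \<kappa>
  for k :: "'x::polish_space \<Rightarrow> 'x \<Rightarrow> real" and H ip \<kappa> +
  fixes Y :: "real set" and P :: "('x \<times> real) measure"
    and L :: "'x \<Rightarrow> real \<Rightarrow> real \<Rightarrow> real" and c lam :: real
  assumes P: "P \<in> borel_prob_measures Y"
    and loss: "is_loss Y L" and convex: "convex_loss Y L"
    and lipschitz: "\<And>x y s t. y \<in> Y \<Longrightarrow> \<bar>L x y s - L x y t\<bar> \<le> c * \<bar>s - t\<bar>"
    and c_nonneg: "0 \<le> c" and lam_pos: "0 < lam"
begin

sublocale prob_space P
  using P by (simp add: borel_prob_measures_def)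

lemma sets_P: "sets P = sets (restrict_space borel (UNIV \<times> Y))"
  using P by (simp add: borel_prob_measures_def)

lemma space_P: "space P = UNIV \<times> Y"
  using sets_eq_imp_space_eq[OF sets_P] by (simp add: space_restrict_space)

lemma snd_mem: "z \<in> space P \<Longrightarrow> snd z \<in> Y"
  by (auto simp: space_P)

lemma measurable_P [measurable_dest]: "f \<in> borel \<rightarrow>\<^sub>M N \<Longrightarrow> f \<in> P \<rightarrow>\<^sub>M N"
  by (subst measurable_cong_sets[OF sets_P refl]) (rule measurable_restrict_space1)

lemma measurable_fst_P [measurable]: "fst \<in> P \<rightarrow>\<^sub>M borel"
  and measurable_snd_P [measurable]: "snd \<in> P \<rightarrow>\<^sub>M borel"
  by (auto intro!: measurable_P borel_measurable_continuous_onI continuous_intros)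

text \<open>Measurability of the loss is given on \<open>UNIV \<times> Y \<times> UNIV\<close> only,
  so the composition factors through that restricted space.\<close>

lemma borel_measurable_loss:
  assumes [measurable]: "f \<in> borel_measurable borel"
  shows "(\<lambda>z. L (fst z) (snd z) (f (fst z))) \<in> borel_measurable P"
proof -
  have "(\<lambda>z. (fst z, snd z, f (fst z))) \<in> P \<rightarrow>\<^sub>M restrict_space borel (UNIV \<times> Y \<times> UNIV)"
    by (rule measurable_restrict_space2) (auto simp: space_P)
  then have "(\<lambda>z. (\<lambda>(x, y, t). L x y t) (fst z, snd z, f (fst z))) \<in> borel_measurable P"
    by (rule measurable_compose) (use loss in \<open>simp add: is_loss_def\<close>)
  then show ?thesis by simp
qed

text \<open>It depends on the loss alone, not on the measure or the kernel, so the two problems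
  compared later share it.\<close>

definition slope :: "real \<Rightarrow> 'x \<times> real \<Rightarrow> real \<Rightarrow> real" where
  "slope \<epsilon> z t = (L (fst z) (snd z) (t + \<epsilon>) - L (fst z) (snd z) t) / \<epsilon>"

lemma borel_measurable_slope:
  assumes [measurable]: "f \<in> borel_measurable borel"
  shows "(\<lambda>z. slope \<epsilon> z (f (fst z))) \<in> borel_measurable P"
  using borel_measurable_loss[of "\<lambda>x. f x + \<epsilon>"] borel_measurable_loss[of f]
  unfolding slope_def by measurable

lemma
  assumes "z \<in> space P" "0 < \<epsilon>"
  shows slope_bound: "\<bar>slope \<epsilon> z t\<bar> \<le> c"
    and slope_lipschitz: "\<bar>slope \<epsilon> z s - slope \<epsilon> z t\<bar> \<le> 2 * c / \<epsilon> * \<bar>s - t\<bar>"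
    and mono_slope: "mono (slope \<epsilon> z)"
    and slope_support:
      "L (fst z) (snd z) t + slope \<epsilon> z t * (s - t) - 2 * c * \<epsilon> \<le> L (fst z) (snd z) s"
proof -
  have conv: "convex_on UNIV (L (fst z) (snd z))"
    using convex snd_mem[OF assms(1)] by (simp add: convex_loss_def)
  have slope: "slope \<epsilon> z = (\<lambda>t. (L (fst z) (snd z) (t + \<epsilon>) - L (fst z) (snd z) t) / \<epsilon>)"
    by (rule ext) (simp add: slope_def)
  note * = conv lipschitz[OF snd_mem[OF assms(1)], of "fst z"] assms(2)
  show "\<bar>slope \<epsilon> z t\<bar> \<le> c"
    "\<bar>slope \<epsilon> z s - slope \<epsilon> z t\<bar> \<le> 2 * c / \<epsilon> * \<bar>s - t\<bar>"
    "mono (slope \<epsilon> z)"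
    "L (fst z) (snd z) t + slope \<epsilon> z t * (s - t) - 2 * c * \<epsilon> \<le> L (fst z) (snd z) s"
    unfolding slope
    by (fact difference_quotient_bound[OF *] difference_quotient_lipschitz[OF *]
        difference_quotient_mono[OF *] difference_quotient_support[OF *])+
qed

text \<open>Weak form of the smoothed optimality condition, tested against all of
  \<open>H\<close>.\<close>

definition stationary :: "real \<Rightarrow> ('x \<Rightarrow> real) \<Rightarrow> bool" where
  "stationary \<epsilon> f \<longleftrightarrow> f \<in> H \<and>
    (\<forall>g\<in>H. 2 * lam * ip f g + (LINT z|P. slope \<epsilon> z (f (fst z)) * g (fst z)) = 0)"

lemma stationary_mem: "stationary \<epsilon> f \<Longrightarrow> f \<in> H"
  and stationary_eq: "stationary \<epsilon> f \<Longrightarrow> g \<in> H \<Longrightarrow>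
    2 * lam * ip f g + (LINT z|P. slope \<epsilon> z (f (fst z)) * g (fst z)) = 0"
  unfolding stationary_def by blast+

lemma stationary_exists:
  assumes "0 < \<epsilon>"
  shows "\<exists>f. stationary \<epsilon> f"
proof (rule monotone_equation_solvable[OF prob_space_axioms measurable_fst_P,
      of "slope \<epsilon>" c "2 * c / \<epsilon>" "2 * lam"])
  show "\<exists>f. stationary \<epsilon> f" if "f \<in> H"
    "\<And>g. g \<in> H \<Longrightarrow> 2 * lam * ip f g + (LINT z|P. slope \<epsilon> z (f (fst z)) * g (fst z)) = 0" for f
    using that unfolding stationary_def by blast
qed (use assms lam_pos c_nonneg slope_bound slope_lipschitz mono_slope borel_measurable_slope in auto)

text \<open>The stationarity equation exhibits \<open>2 * lam * f\<close> as the embedding of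
  weights bounded by \<open>c\<close>.\<close>

lemma nrm_stationary_le:
  assumes "stationary \<epsilon> f" "0 < \<epsilon>"
  shows "nrm f \<le> c * \<kappa> / (2 * lam)"
proof -
  note f = stationary_mem[OF assms(1)]
  have "nrm (\<lambda>x. 2 * lam * f x) \<le> c * \<kappa>"
  proof (rule nrm_embedding_le[OF prob_space_axioms scale_mem[OF f]])
    show "\<bar>- slope \<epsilon> z (f (fst z))\<bar> \<le> c" if "z \<in> space P" for z
      using slope_bound[OF that assms(2)] by simp
    show "ip (\<lambda>x. 2 * lam * f x) (\<lambda>x. 2 * lam * f x)
      = (LINT z|P. - slope \<epsilon> z (f (fst z)) * (2 * lam * f (fst z)))"
      using stationary_eq[OF assms(1) scale_mem[OF f], of "2 * lam"] f by (simp add: ip_scale_left)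
  qed
  then have "nrm f * (2 * lam) \<le> c * \<kappa>" using lam_pos unfolding nrm_scale[OF f] by (simp add: mult.commute)
  then show ?thesis using lam_pos by (simp add: pos_le_divide_eq)
qed

definition objective :: "('x \<Rightarrow> real) \<Rightarrow> real" where
  "objective f = risk (shifted_loss L) P f + lam * (nrm f)\<^sup>2"

lemma abs_shifted_loss_diff_le:
  assumes "f \<in> H" "g \<in> H" "z \<in> space P"
  shows "\<bar>shifted_loss L (fst z) (snd z) (f (fst z)) - shifted_loss L (fst z) (snd z) (g (fst z))\<bar>
    \<le> c * (\<kappa> * nrm (\<lambda>x. f x - g x))"
proof -
  have "\<bar>L (fst z) (snd z) (f (fst z)) - L (fst z) (snd z) (g (fst z))\<bar> \<le> c * \<bar>f (fst z) - g (fst z)\<bar>"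
    using lipschitz[OF snd_mem[OF assms(3)]] .
  also have "\<dots> \<le> c * (\<kappa> * nrm (\<lambda>x. f x - g x))"
    using abs_le_nrm[OF diff_mem[OF assms(1,2)]] c_nonneg by (rule mult_left_mono)
  finally show ?thesis by (simp add: shifted_loss_def)
qed

lemma integrable_shifted_loss:
  assumes "f \<in> H"
  shows "integrable P (\<lambda>z. shifted_loss L (fst z) (snd z) (f (fst z)))"
proof (rule integrable_const_bound[of _ "c * (\<kappa> * nrm f)"])
  show "(\<lambda>z. shifted_loss L (fst z) (snd z) (f (fst z))) \<in> borel_measurable P"
    unfolding shifted_loss_def
    using borel_measurable_loss[OF borel_measurable_mem[OF assms]] borel_measurable_loss[of "\<lambda>x. 0"]
    by measurable
  show "AE z in P. norm (shifted_loss L (fst z) (snd z) (f (fst z))) \<le> c * (\<kappa> * nrm f)"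
    using abs_shifted_loss_diff_le[OF assms zero_mem] by (intro AE_I2) (simp add: shifted_loss_def)
qed

lemma risk_lipschitz:
  assumes "f \<in> H" "g \<in> H"
  shows "\<bar>risk (shifted_loss L) P f - risk (shifted_loss L) P g\<bar> \<le> c * (\<kappa> * nrm (\<lambda>x. f x - g x))"
  unfolding risk_def
    Bochner_Integration.integral_diff[OF integrable_shifted_loss[OF assms(1)] integrable_shifted_loss[OF assms(2)], symmetric]
  using abs_shifted_loss_diff_le[OF assms] by (rule abs_expectation_le)

lemma integrable_slope_mult:
  assumes "f \<in> H" "g \<in> H" "0 < \<epsilon>"
  shows "integrable P (\<lambda>z. slope \<epsilon> z (f (fst z)) * g (fst z))"
proof (rule integrable_const_bound[of _ "c * (\<kappa> * nrm g)"])
  show "AE z in P. norm (slope \<epsilon> z (f (fst z)) * g (fst z)) \<le> c * (\<kappa> * nrm g)"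
    using abs_mult_mem_le[OF assms(2) slope_bound[OF _ assms(3)]] by (intro AE_I2) simp
  show "(\<lambda>z. slope \<epsilon> z (f (fst z)) * g (fst z)) \<in> borel_measurable P"
    using borel_measurable_slope[OF borel_measurable_mem[OF assms(1)]] borel_measurable_mem[OF assms(2)]
    by measurable
qed

text \<open>Integrating the support inequality of the slopes and replacing the linear term by
  stationarity leaves exactly the quadratic remainder of the squared norm. This remainder later
  controls distances to \<open>f\<close>.\<close>

lemma objective_stationary_le:
  assumes "stationary \<epsilon> f" "0 < \<epsilon>" and g: "g \<in> H"
  shows "objective f + lam * (nrm (\<lambda>x. g x - f x))\<^sup>2 - 2 * c * \<epsilon> \<le> objective g"
proof -
  note f = stationary_mem[OF assms(1)]
  have eq: "2 * lam * ip f (\<lambda>x. g x - f x)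
      + (LINT z|P. slope \<epsilon> z (f (fst z)) * (g (fst z) - f (fst z))) = 0"
    using stationary_eq[OF assms(1) diff_mem[OF g f]] .
  have int: "integrable P (\<lambda>z. slope \<epsilon> z (f (fst z)) * (g (fst z) - f (fst z)))"
    using integrable_slope_mult[OF f diff_mem[OF g f] assms(2)] .
  have "risk (shifted_loss L) P f + (LINT z|P. slope \<epsilon> z (f (fst z)) * (g (fst z) - f (fst z))) - 2 * c * \<epsilon>
    = (LINT z|P. shifted_loss L (fst z) (snd z) (f (fst z))
        + slope \<epsilon> z (f (fst z)) * (g (fst z) - f (fst z)) - 2 * c * \<epsilon>)"
    unfolding risk_def using integrable_shifted_loss[OF f] int by (simp add: prob_space)
  also have "\<dots> \<le> risk (shifted_loss L) P g"
    unfolding risk_def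
  proof (rule integral_mono)
    show "shifted_loss L (fst z) (snd z) (f (fst z)) + slope \<epsilon> z (f (fst z)) * (g (fst z) - f (fst z)) - 2 * c * \<epsilon>
      \<le> shifted_loss L (fst z) (snd z) (g (fst z))" if "z \<in> space P" for z
      using slope_support[OF that assms(2), of "f (fst z)" "g (fst z)"] by (simp add: shifted_loss_def)
  qed (use integrable_shifted_loss f g int in auto)
  finally have "risk (shifted_loss L) P f - 2 * lam * ip f (\<lambda>x. g x - f x) - 2 * c * \<epsilon>
      \<le> risk (shifted_loss L) P g"
    using eq by simp
  moreover have "lam * (nrm (\<lambda>x. g x - f x))\<^sup>2
      = lam * (nrm g)\<^sup>2 - lam * (nrm f)\<^sup>2 - 2 * lam * ip f (\<lambda>x. g x - f x)"
    using f g by (simp add: nrm_diff_square nrm_square ip_diff_right ip_commute[of g f] algebra_simps)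
  ultimately show ?thesis by (simp add: objective_def)
qed

theorem minimizer_exists: "\<exists>f\<in>H. \<forall>g\<in>H. objective f \<le> objective g"
proof -
  define e where "e n = inverse (real (Suc n))" for n
  have e: "0 < e n" for n by (simp add: e_def)
  have e0: "e \<longlonglongrightarrow> 0" unfolding e_def by (rule LIMSEQ_inverse_real_of_nat)
  obtain u where u: "\<And>n. stationary (e n) (u n)"
    using stationary_exists[OF e] by metis
  have uH: "u n \<in> H" for n using stationary_mem[OF u] .
  note approx = objective_stationary_le[OF u e]
  \<comment> \<open>Each of \<open>u m\<close> and \<open>u n\<close> serves as competitor for the
    other; in the sum of the two inequalities the objectives cancel.\<close>
  have "(nrm (\<lambda>x. u m x - u n x))\<^sup>2 \<le> c / lam * e m + c / lam * e n" for m n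
    using approx[OF uH, of m n] approx[OF uH, of n m] nrm_diff_commute[OF uH uH, of m n] lam_pos
    by (simp add: field_simps)
  moreover have "(\<lambda>n. c / lam * e n) \<longlonglongrightarrow> 0"
    using tendsto_mult_right_zero[OF e0] .
  ultimately obtain f where f: "f \<in> H" and lim: "(\<lambda>n. nrm (\<lambda>x. u n x - f x)) \<longlonglongrightarrow> 0"
    using Cauchy_bound_convergent[of u "\<lambda>n. c / lam * e n"] uH by blast
  have "(\<lambda>n. risk (shifted_loss L) P (u n) - risk (shifted_loss L) P f) \<longlonglongrightarrow> 0"
  proof (rule Lim_null_comparison[OF always_eventually])
    show "\<forall>n. norm (risk (shifted_loss L) P (u n) - risk (shifted_loss L) P f) \<le> c * (\<kappa> * nrm (\<lambda>x. u n x - f x))"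
      using risk_lipschitz[OF uH f] by simp
    show "(\<lambda>n. c * (\<kappa> * nrm (\<lambda>x. u n x - f x))) \<longlonglongrightarrow> 0"
      by (intro tendsto_mult_right_zero lim)
  qed
  then have R: "(\<lambda>n. risk (shifted_loss L) P (u n)) \<longlonglongrightarrow> risk (shifted_loss L) P f"
    by (rule LIM_zero_cancel)
  have "(\<lambda>n. nrm (u n) - nrm f) \<longlonglongrightarrow> 0"
  proof (rule Lim_null_comparison[OF always_eventually lim], rule allI)
    fix n
    show "norm (nrm (u n) - nrm f) \<le> nrm (\<lambda>x. u n x - f x)"
      using nrm_add_le[of "\<lambda>x. u n x - f x" f] nrm_add_le[of "\<lambda>x. f x - u n x" "u n"]
        nrm_diff_commute[OF uH[of n] f] uH f by (simp add: abs_le_iff)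
  qed
  then have N: "(\<lambda>n. nrm (u n)) \<longlonglongrightarrow> nrm f"
    by (rule LIM_zero_cancel)
  have "objective f \<le> objective g" if g: "g \<in> H" for g
  proof (rule LIMSEQ_le)
    show "(\<lambda>n. objective (u n)) \<longlonglongrightarrow> objective f"
      unfolding objective_def by (intro tendsto_intros R N)
    show "(\<lambda>n. objective g + 2 * c * e n) \<longlonglongrightarrow> objective g"
      using tendsto_add[OF tendsto_const tendsto_mult_right_zero[OF e0], of "objective g" "2 * c"] by simp
    have "objective (u n) \<le> objective g + 2 * c * e n" for n
    proof -
      have "0 \<le> lam * (nrm (\<lambda>x. g x - u n x))\<^sup>2" using lam_pos by simp
      then show ?thesis using approx[OF g, of n] by linarith
    qed
    then show "\<exists>N. \<forall>n\<ge>N. objective (u n) \<le> objective g + 2 * c * e n" by blast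
  qed
  with f show ?thesis by blast
qed

abbreviation f_svm :: "'x \<Rightarrow> real" where
  "f_svm \<equiv> svm L P lam H ip"

text \<open>As \<open>svm\<close> is a choice through \<open>arg_min_on\<close>, it is known to be a
  minimizer only once one exists.\<close>

lemma svm_mem: "f_svm \<in> H"
  and svm_minimal: "g \<in> H \<Longrightarrow> objective f_svm \<le> objective g"
proof -
  have "\<exists>f. is_arg_min objective (\<lambda>f. f \<in> H) f"
    using minimizer_exists by (auto simp: is_arg_min_linorder)
  then have "is_arg_min objective (\<lambda>f. f \<in> H) f_svm"
    unfolding svm_def arg_min_on_def arg_min_def objective_def[abs_def, symmetric] by (rule someI_ex)
  then show "f_svm \<in> H" "g \<in> H \<Longrightarrow> objective f_svm \<le> objective g"
    by (auto simp: is_arg_min_linorder)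
qed

text \<open>With \<open>f_svm\<close> as competitor, minimality removes the objectives from
  \<open>objective_stationary_le\<close>; evaluation then costs a factor
  \<open>\<kappa>\<close>.\<close>

lemma abs_svm_diff_stationary_le:
  assumes "stationary \<epsilon> f" "0 < \<epsilon>"
  shows "\<bar>f_svm x - f x\<bar> \<le> \<kappa> * sqrt (2 * c * \<epsilon> / lam)"
proof -
  note f = stationary_mem[OF assms(1)]
  have "lam * (nrm (\<lambda>x. f_svm x - f x))\<^sup>2 \<le> 2 * c * \<epsilon>"
    using objective_stationary_le[OF assms svm_mem] svm_minimal[OF f] by linarith
  then have "(nrm (\<lambda>x. f_svm x - f x))\<^sup>2 \<le> 2 * c * \<epsilon> / lam"
    using lam_pos by (simp add: field_simps)
  then have "nrm (\<lambda>x. f_svm x - f x) \<le> sqrt (2 * c * \<epsilon> / lam)"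
    by (rule real_le_rsqrt)
  then show ?thesis
    using abs_le_nrm[OF diff_mem[OF svm_mem f], of x] kappa_nonneg
    by (meson mult_left_mono order_trans)
qed

lemma borel_measurable_svm: "f_svm \<in> borel_measurable borel"
  using borel_measurable_mem[OF svm_mem] .

end

section \<open>Comparison of two problems, first pointwise and then in the Lp norm\<close>

section \<open>Stability\<close>

text \<open>Otherwise \<open>d - b\<close> and \<open>d\<close> both exceed \<open>sqrt a\<close>,
  so \<open>d * (d - b)\<close> would exceed \<open>a\<close>.\<close>

lemma le_add_sqrt_of_square_le:
  fixes a b d :: real
  assumes "d\<^sup>2 \<le> a + b * d" "0 \<le> a" "0 \<le> b"
  shows "d \<le> b + sqrt a"
proof (rule ccontr)
  assume "\<not> d \<le> b + sqrt a"
  then have "sqrt a < d - b" by simp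
  then have "sqrt a * sqrt a < d * (d - b)"
    using assms by (intro mult_strict_mono') auto
  then show False using assms by (simp add: power2_eq_square algebra_simps)
qed

lemma tv_norm_restrict_nonneg:
  fixes P1 :: "('x::topological_space \<times> real) measure"
  assumes "P1 \<in> borel_prob_measures Y" "P2 \<in> borel_prob_measures Y"
  shows "0 \<le> tv_norm (restrict_space borel (UNIV \<times> Y)) (\<lambda>E. measure P1 E - measure P2 E)"
  using assms by (intro tv_norm_nonneg) (auto simp: borel_prob_measures_def prob_space_def)

text \<open>The kernel difference is integrated under \<open>P1\<close> throughout; the estimate
  under the other measure comes from exchanging the problems.\<close>

context
  fixes k1 k2 :: "'x::polish_space \<Rightarrow> 'x \<Rightarrow> real" and H1 H2 ip1 ip2 \<kappa> Y P1 P2 L c lam1 lam2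
  assumes problem1: "svm_problem k1 H1 ip1 \<kappa> Y P1 L c lam1"
    and problem2: "svm_problem k2 H2 ip2 \<kappa> Y P2 L c lam2"
begin

interpretation S1: svm_problem k1 H1 ip1 \<kappa> Y P1 L c lam1 by (fact problem1)
interpretation S2: svm_problem k2 H2 ip2 \<kappa> Y P2 L c lam2 by (fact problem2)

private abbreviation (input) "tv \<equiv> tv_norm (restrict_space borel (UNIV \<times> Y)) (\<lambda>E. measure P1 E - measure P2 E)"

private definition kernel_gap :: "'x \<Rightarrow> real" where
  "kernel_gap x = (LINT y|x_marginal P1. \<bar>k1 x y - k2 x y\<bar>)"

text \<open>This is the bound \<open>b + sqrt a\<close> from the quadratic inequality for the
  distance in \<open>H2\<close>. Its terms account for the change of measure, of regularization and
  of kernel.\<close>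

private definition rkhs_gap :: real where
  "rkhs_gap = c * \<kappa> * tv / (2 * lam1) + \<bar>lam1 - lam2\<bar> * c * \<kappa> / (2 * lam1 * lam2)
    + sqrt (c\<^sup>2 * (LINT x|x_marginal P1. kernel_gap x) / (2 * lam1\<^sup>2))"

private lemma prob_space_marginal: "prob_space (x_marginal P1)"
  unfolding x_marginal_def by (rule S1.prob_space_distr) (rule S1.measurable_fst_P)

private lemma sets_marginal [simp, measurable_cong]: "sets (x_marginal P1) = sets borel"
  by (simp add: x_marginal_def)

private lemma borel_measurable_kernel_diff:
  "(\<lambda>(x, y). k1 x y - k2 x y) \<in> borel_measurable (borel \<Otimes>\<^sub>M borel)"
  using borel_measurable_diff[OF S1.measurable_kernel S2.measurable_kernel]
  by (simp add: borel_prod case_prod_beta')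

private lemma abs_kernel_diff_le: "\<bar>k1 x y - k2 x y\<bar> \<le> 2 * \<kappa>\<^sup>2"
  using S1.abs_kernel_le[of x y] S2.abs_kernel_le[of x y] by linarith

private lemma borel_measurable_kernel_diff_section:
  "(\<lambda>y. \<bar>k1 x y - k2 x y\<bar>) \<in> borel_measurable borel"
  using measurable_compose[OF measurable_Pair1' borel_measurable_kernel_diff, of x] by simp

private lemma borel_measurable_kernel_gap: "kernel_gap \<in> borel_measurable borel"
proof -
  interpret M: prob_space "x_marginal P1" by (rule prob_space_marginal)
  have "(\<lambda>z. \<bar>case z of (x, y) \<Rightarrow> k1 x y - k2 x y\<bar>) \<in> borel_measurable (borel \<Otimes>\<^sub>M x_marginal P1)"
    using borel_measurable_abs[OF borel_measurable_kernel_diff] by (simp cong: measurable_cong_sets)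
  then show ?thesis
    unfolding kernel_gap_def[abs_def]
    by (intro M.borel_measurable_lebesgue_integral) (simp add: case_prod_beta')
qed

private lemma kernel_gap_bounds: "0 \<le> kernel_gap x" "kernel_gap x \<le> 2 * \<kappa>\<^sup>2"
proof -
  interpret M: prob_space "x_marginal P1" by (rule prob_space_marginal)
  show "0 \<le> kernel_gap x" by (simp add: kernel_gap_def)
  show "kernel_gap x \<le> 2 * \<kappa>\<^sup>2"
    unfolding kernel_gap_def using abs_kernel_diff_le borel_measurable_kernel_diff_section
    by (intro M.integral_le_const M.integrable_const_bound[of _ "2 * \<kappa>\<^sup>2"])
      (auto cong: measurable_cong_sets)
qed

private lemma kernel_gap_eq: "kernel_gap x = (LINT z|P1. \<bar>k1 (fst z) x - k2 (fst z) x\<bar>)"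
  unfolding kernel_gap_def x_marginal_def
  using integral_distr[OF S1.measurable_fst_P borel_measurable_kernel_diff_section, of x]
  by (simp add: S1.kernel_commute[of x] S2.kernel_commute[of x])

private lemma integral_kernel_gap_eq: "(LINT x|x_marginal P1. kernel_gap x) = (LINT z|P1. kernel_gap (fst z))"
  unfolding x_marginal_def using integral_distr[OF S1.measurable_fst_P borel_measurable_kernel_gap] .

private lemma rkhs_gap_nonneg: "0 \<le> rkhs_gap"
  unfolding rkhs_gap_def
  using tv_norm_restrict_nonneg[OF S1.P S2.P] S1.c_nonneg S1.kappa_nonneg S1.lam_pos S2.lam_pos kernel_gap_bounds(1)
  by (intro add_nonneg_nonneg divide_nonneg_pos mult_nonneg_nonneg real_sqrt_ge_zero integral_nonneg_AE) auto

text \<open>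
  The element \<open>g\<close> of \<open>H2\<close> carries the dual weights of the first problem over to the second
  kernel. It is compared with \<open>f1\<close> through the difference of the kernels, and with \<open>f2\<close> inside
  \<open>H2\<close> by monotonicity of the slopes.
\<close>

private lemma abs_stationary_diff_le:
  assumes f1: "S1.stationary \<epsilon> f1" and f2: "S2.stationary \<epsilon> f2" and "0 < \<epsilon>"
  shows "\<bar>f1 x - f2 x\<bar> \<le> c / (2 * lam1) * kernel_gap x + \<kappa> * rkhs_gap"
proof -
  note mem1 = S1.stationary_mem[OF f1] and mem2 = S2.stationary_mem[OF f2]
  have pos: "0 < lam1" "0 < lam2" "0 \<le> c" "0 \<le> \<kappa>"
    using S1.lam_pos S2.lam_pos S1.c_nonneg S1.kappa_nonneg by auto
  define w1 where "w1 z = S1.slope \<epsilon> z (f1 (fst z))" for z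
  define w2 where "w2 z = S1.slope \<epsilon> z (f2 (fst z))" for z
  note [measurable] = S1.measurable_fst_P
  have w1_meas[measurable]: "w1 \<in> borel_measurable P1"
    unfolding w1_def by (rule S1.borel_measurable_slope[OF S1.borel_measurable_mem[OF mem1]])
  have w2_meas[measurable]: "w2 \<in> borel_measurable P1"
    unfolding w2_def by (rule S1.borel_measurable_slope[OF S2.borel_measurable_mem[OF mem2]])
  have w1: "\<bar>w1 z\<bar> \<le> c" and w2: "\<bar>w2 z\<bar> \<le> c" if "z \<in> space P1" for z
    unfolding w1_def w2_def by (rule S1.slope_bound[OF that \<open>0 < \<epsilon>\<close>])+
  obtain v where v: "v \<in> H2" "\<And>u. u \<in> H2 \<Longrightarrow> ip2 v u = (LINT z|P1. w1 z * u (fst z))"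
    using S2.embedding[OF S1.prob_space_axioms S1.measurable_fst_P w1_meas w1] by metis
  define g where "g = (\<lambda>x. (- 1 / (2 * lam1)) * v x)"
  have g: "g \<in> H2" unfolding g_def by (rule S2.scale_mem[OF v(1)])
  have g_ip: "2 * lam1 * ip2 g u = - (LINT z|P1. w1 z * u (fst z))" if "u \<in> H2" for u
    using pos that v unfolding g_def by (simp only: S2.ip_scale_left[OF v(1) that]) simp
  have int1: "integrable P1 (\<lambda>z. w1 z * k1 (fst z) x)" "integrable P1 (\<lambda>z. w1 z * k2 (fst z) x)" for x
  proof -
    have [measurable]: "(\<lambda>y. k1 y x) \<in> borel_measurable borel" "(\<lambda>y. k2 y x) \<in> borel_measurable borel"
      by (rule S1.borel_measurable_section S2.borel_measurable_section)+
    show "integrable P1 (\<lambda>z. w1 z * k1 (fst z) x)"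
      using S1.abs_mult_mem_le[OF S1.section_mem w1]
      by (intro S1.integrable_const_bound[of _ "c * (\<kappa> * S1.nrm (\<lambda>y. k1 y x))"]) auto
    show "integrable P1 (\<lambda>z. w1 z * k2 (fst z) x)"
      using S2.abs_mult_mem_le[OF S2.section_mem w1]
      by (intro S1.integrable_const_bound[of _ "c * (\<kappa> * S2.nrm (\<lambda>y. k2 y x))"]) auto
  qed
  \<comment> \<open>Tested against sections at \<open>x\<close>, the equations of \<open>f1\<close>
    and \<open>g\<close> have the same weights and measure and differ only in the kernel.\<close>
  have f1_g: "\<bar>f1 x - g x\<bar> \<le> c / (2 * lam1) * kernel_gap x" for x
  proof -
    have gap_int: "integrable P1 (\<lambda>z. \<bar>k1 (fst z) x - k2 (fst z) x\<bar>)"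
      using abs_kernel_diff_le measurable_compose[OF S1.measurable_fst_P borel_measurable_kernel_diff_section[of x]]
      by (intro S1.integrable_const_bound[of _ "2 * \<kappa>\<^sup>2"])
        (auto simp: S1.kernel_commute[of x] S2.kernel_commute[of x])
    have "2 * lam1 * f1 x = - (LINT z|P1. w1 z * k1 (fst z) x)"
      using S1.stationary_eq[OF f1 S1.section_mem[of x]] S1.reproducing[OF mem1, of x] by (simp add: w1_def)
    moreover have "2 * lam1 * g x = - (LINT z|P1. w1 z * k2 (fst z) x)"
      using g_ip[OF S2.section_mem[of x]] S2.reproducing[OF g, of x] by simp
    ultimately have "2 * lam1 * (f1 x - g x) = - (LINT z|P1. w1 z * (k1 (fst z) x - k2 (fst z) x))"
      using int1 by (simp add: right_diff_distrib)
    then have "\<bar>2 * lam1 * (f1 x - g x)\<bar> = \<bar>LINT z|P1. w1 z * (k1 (fst z) x - k2 (fst z) x)\<bar>"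
      by simp
    also have "\<dots> \<le> (LINT z|P1. \<bar>w1 z * (k1 (fst z) x - k2 (fst z) x)\<bar>)"
      by (rule integral_abs_bound)
    also have "\<dots> \<le> (LINT z|P1. c * \<bar>k1 (fst z) x - k2 (fst z) x\<bar>)"
    proof (rule integral_mono)
      show "integrable P1 (\<lambda>z. \<bar>w1 z * (k1 (fst z) x - k2 (fst z) x)\<bar>)"
        using Bochner_Integration.integrable_diff[OF int1] by (simp add: right_diff_distrib)
      show "\<bar>w1 z * (k1 (fst z) x - k2 (fst z) x)\<bar> \<le> c * \<bar>k1 (fst z) x - k2 (fst z) x\<bar>" if "z \<in> space P1" for z
        unfolding abs_mult using w1[OF that] by (rule mult_right_mono) simp
    qed (use gap_int in simp)
    also have "\<dots> = c * kernel_gap x"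
      unfolding kernel_gap_eq by simp
    finally have "\<bar>f1 x - g x\<bar> * (2 * lam1) \<le> c * kernel_gap x"
      using pos by (simp add: abs_mult mult.commute)
    then show ?thesis using pos by (simp add: pos_le_divide_eq)
  qed
  let ?d = "\<lambda>x. g x - f2 x"
  define D where "D = S2.nrm ?d"
  have d: "?d \<in> H2" using g mem2 by (rule S2.diff_mem)
  have [measurable]: "?d \<in> borel_measurable borel" "f1 \<in> borel_measurable borel" "f2 \<in> borel_measurable borel"
    "kernel_gap \<in> borel_measurable borel" "g \<in> borel_measurable borel"
    using S2.borel_measurable_mem[OF d] S1.borel_measurable_mem[OF mem1] S2.borel_measurable_mem[OF mem2]
      borel_measurable_kernel_gap S2.borel_measurable_mem[OF g] by auto
  have "0 \<le> D" unfolding D_def using S2.nrm_nonneg[OF d] .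
  define I where "I = (LINT x|x_marginal P1. kernel_gap x)"
  have int_wd: "integrable P1 (\<lambda>z. w1 z * ?d (fst z))" "integrable P1 (\<lambda>z. w2 z * ?d (fst z))"
    using S2.abs_mult_mem_le[OF d w1] S2.abs_mult_mem_le[OF d w2]
    by (auto intro!: S1.integrable_const_bound[of _ "c * (\<kappa> * D)"] simp: D_def)
  \<comment> \<open>Splitting \<open>g - f2\<close> as \<open>(f1 - f2) - (f1 - g)\<close>,
    monotonicity gives the first part a favourable sign. In the rest \<open>w1 - w2\<close> is at
    most \<open>2 * c\<close> in modulus and \<open>f1_g\<close> applies.\<close>
  have same: "- (LINT z|P1. (w1 z - w2 z) * ?d (fst z)) \<le> c\<^sup>2 / lam1 * I"
  proof -
    have "- (LINT z|P1. (w1 z - w2 z) * ?d (fst z)) = (LINT z|P1. - ((w1 z - w2 z) * ?d (fst z)))"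
      by simp
    also have "\<dots> \<le> (LINT z|P1. c\<^sup>2 / lam1 * kernel_gap (fst z))"
    proof (rule integral_mono)
      show "integrable P1 (\<lambda>z. - ((w1 z - w2 z) * ?d (fst z)))"
        using int_wd by (simp add: left_diff_distrib)
      show "integrable P1 (\<lambda>z. c\<^sup>2 / lam1 * kernel_gap (fst z))"
        using kernel_gap_bounds by (intro integrable_mult_right S1.integrable_const_bound[of _ "2 * \<kappa>\<^sup>2"]) auto
      fix z assume z: "z \<in> space P1"
      let ?x = "fst z"
      have "0 \<le> (w1 z - w2 z) * (f1 ?x - f2 ?x)"
        using monoD[OF S1.mono_slope[OF z \<open>0 < \<epsilon>\<close>], of "f1 ?x" "f2 ?x"]
          monoD[OF S1.mono_slope[OF z \<open>0 < \<epsilon>\<close>], of "f2 ?x" "f1 ?x"]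
        by (cases "f1 ?x \<le> f2 ?x") (auto simp: zero_le_mult_iff w1_def w2_def)
      then have "- ((w1 z - w2 z) * ?d ?x) \<le> (w1 z - w2 z) * (f1 ?x - g ?x)"
        by (simp add: algebra_simps)
      also have "\<dots> \<le> \<bar>w1 z - w2 z\<bar> * \<bar>f1 ?x - g ?x\<bar>"
        unfolding abs_mult[symmetric] by (rule abs_ge_self)
      also have "\<dots> \<le> (2 * c) * (c / (2 * lam1) * kernel_gap ?x)"
        using w1[OF z] w2[OF z] f1_g[of ?x] by (intro mult_mono) auto
      finally show "- ((w1 z - w2 z) * ?d ?x) \<le> c\<^sup>2 / lam1 * kernel_gap ?x"
        by (simp add: power2_eq_square)
    qed
    finally show ?thesis by (simp add: I_def integral_kernel_gap_eq)
  qed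
  have change: "\<bar>(LINT z|P1. w2 z * ?d (fst z)) - (LINT z|P2. w2 z * ?d (fst z))\<bar> \<le> c * (\<kappa> * D) * tv"
  proof (rule integral_diff_le_tv_norm[OF S1.prob_space_axioms S2.prob_space_axioms S1.sets_P S2.sets_P])
    show "(\<lambda>z. w2 z * ?d (fst z)) \<in> borel_measurable (restrict_space borel (UNIV \<times> Y))"
      by (subst measurable_cong_sets[OF S1.sets_P[symmetric] refl]) measurable
    show "\<bar>w2 z * ?d (fst z)\<bar> \<le> c * (\<kappa> * D)" if "z \<in> space (restrict_space borel (UNIV \<times> Y))" for z
      unfolding D_def
      by (rule S2.abs_mult_mem_le[OF d w2]) (use that in \<open>simp add: space_restrict_space S1.space_P\<close>)
  qed (use pos \<open>0 \<le> D\<close> in simp)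
  have f2_eq: "2 * lam2 * ip2 f2 ?d = - (LINT z|P2. w2 z * ?d (fst z))"
    using S2.stationary_eq[OF f2 d] by (simp add: w2_def)
  have "\<bar>ip2 f2 ?d\<bar> \<le> c * \<kappa> / (2 * lam2) * D"
    using S2.Cauchy_Schwarz[OF mem2 d] mult_right_mono[OF S2.nrm_stationary_le[OF f2 \<open>0 < \<epsilon>\<close>] \<open>0 \<le> D\<close>]
    unfolding D_def by linarith
  \<comment> \<open>This is the cost of writing the equation of \<open>f2\<close> with
    \<open>lam1\<close> in place of \<open>lam2\<close>.\<close>
  then have reg: "\<bar>2 * (lam2 - lam1) * ip2 f2 ?d\<bar> \<le> 2 * \<bar>lam1 - lam2\<bar> * (c * \<kappa> / (2 * lam2) * D)"
    unfolding abs_mult by (intro mult_mono) (auto simp: abs_minus_commute)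
  have "2 * lam1 * D\<^sup>2 = 2 * lam1 * ip2 g ?d - 2 * lam2 * ip2 f2 ?d + 2 * (lam2 - lam1) * ip2 f2 ?d"
    unfolding D_def S2.nrm_square[OF d] S2.ip_diff_left[OF g mem2 d] by (simp add: algebra_simps)
  also have "\<dots> = - (LINT z|P1. (w1 z - w2 z) * ?d (fst z))
      - ((LINT z|P1. w2 z * ?d (fst z)) - (LINT z|P2. w2 z * ?d (fst z))) + 2 * (lam2 - lam1) * ip2 f2 ?d"
    unfolding g_ip[OF d] f2_eq left_diff_distrib[of "w1 _"]
      Bochner_Integration.integral_diff[OF int_wd] by simp
  also have "\<dots> \<le> c\<^sup>2 / lam1 * I + c * (\<kappa> * D) * tv + 2 * \<bar>lam1 - lam2\<bar> * (c * \<kappa> / (2 * lam2) * D)"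
    using same change reg by linarith
  finally have "D\<^sup>2 \<le> (c\<^sup>2 / lam1 * I + c * (\<kappa> * D) * tv + 2 * \<bar>lam1 - lam2\<bar> * (c * \<kappa> / (2 * lam2) * D)) / (2 * lam1)"
    using pos by (simp add: pos_le_divide_eq mult.commute)
  also have "\<dots> = c\<^sup>2 * I / (2 * lam1\<^sup>2)
      + (c * \<kappa> * tv / (2 * lam1) + \<bar>lam1 - lam2\<bar> * c * \<kappa> / (2 * lam1 * lam2)) * D"
    using pos by (simp add: field_simps power2_eq_square)
  finally have "D \<le> rkhs_gap"
    unfolding rkhs_gap_def I_def[symmetric]
  proof (rule le_add_sqrt_of_square_le)
    have "0 \<le> I" unfolding I_def using kernel_gap_bounds(1) by (intro integral_nonneg_AE) auto
    then show "0 \<le> c\<^sup>2 * I / (2 * lam1\<^sup>2)" by simp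
    show "0 \<le> c * \<kappa> * tv / (2 * lam1) + \<bar>lam1 - lam2\<bar> * c * \<kappa> / (2 * lam1 * lam2)"
      using pos tv_norm_restrict_nonneg[OF S1.P S2.P] by simp
  qed
  then have "\<bar>g x - f2 x\<bar> \<le> \<kappa> * rkhs_gap"
    using S2.abs_le_nrm[OF d, of x] mult_left_mono[OF _ pos(4), of D rkhs_gap] unfolding D_def by linarith
  then show ?thesis using f1_g[of x] by linarith
qed

text \<open>Stationary points for the same \<open>\<epsilon>\<close> approximate both minimizers
  with errors of order \<open>sqrt \<epsilon>\<close>, which vanish as \<open>\<epsilon>\<close>
  decreases to 0.\<close>

private lemma abs_svm_diff_le:
  "\<bar>S1.f_svm x - S2.f_svm x\<bar> \<le> c / (2 * lam1) * kernel_gap x + \<kappa> * rkhs_gap" (is "?l \<le> ?r")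
proof (rule tendsto_lowerbound)
  show "((\<lambda>\<epsilon>. ?r + \<kappa> * sqrt (2 * c * \<epsilon> / lam1) + \<kappa> * sqrt (2 * c * \<epsilon> / lam2)) \<longlongrightarrow> ?r) (at_right 0)"
    using S1.lam_pos S2.lam_pos by (auto intro!: tendsto_eq_intros)
  show "\<forall>\<^sub>F \<epsilon> in at_right 0. ?l \<le> ?r + \<kappa> * sqrt (2 * c * \<epsilon> / lam1) + \<kappa> * sqrt (2 * c * \<epsilon> / lam2)"
    using eventually_at_right_less[of "0::real"]
  proof eventually_elim
    fix \<epsilon> :: real assume "0 < \<epsilon>"
    obtain f1 f2 where f: "S1.stationary \<epsilon> f1" "S2.stationary \<epsilon> f2"
      using S1.stationary_exists[OF \<open>0 < \<epsilon>\<close>] S2.stationary_exists[OF \<open>0 < \<epsilon>\<close>] by blast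
    show "?l \<le> ?r + \<kappa> * sqrt (2 * c * \<epsilon> / lam1) + \<kappa> * sqrt (2 * c * \<epsilon> / lam2)"
      using abs_stationary_diff_le[OF f \<open>0 < \<epsilon>\<close>, of x] S1.abs_svm_diff_stationary_le[OF f(1) \<open>0 < \<epsilon>\<close>, of x]
        S2.abs_svm_diff_stationary_le[OF f(2) \<open>0 < \<epsilon>\<close>, of x] by linarith
  qed
qed simp

theorem Lp_norm_svm_diff_le:
  fixes p \<tau> :: real
  assumes p: "1 \<le> p" and \<tau>: "\<tau> = min lam1 lam2"
  defines "K \<equiv> Lp_norm p (x_marginal P1 \<Otimes>\<^sub>M x_marginal P1) (\<lambda>(x, x'). k1 x x' - k2 x x')"
  shows "Lp_norm p (x_marginal P1) (\<lambda>x. svm L P1 lam1 H1 ip1 x - svm L P2 lam2 H2 ip2 x)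
    \<le> c / \<tau> * (\<kappa>\<^sup>2 * tv + \<kappa>\<^sup>2 / \<tau> * \<bar>lam1 - lam2\<bar> + 1 / 2 * K + \<kappa> * sqrt K)"
proof -
  interpret M: prob_space "x_marginal P1" by (rule prob_space_marginal)
  have pos: "0 < \<tau>" "\<tau> \<le> lam1" "\<tau> \<le> lam2" "0 < lam1" "0 < lam2" "0 \<le> c" "0 \<le> \<kappa>"
    using S1.lam_pos S2.lam_pos S1.c_nonneg S1.kappa_nonneg \<tau> by auto
  have tv: "0 \<le> tv" using tv_norm_restrict_nonneg[OF S1.P S2.P] .
  have "0 \<le> K" by (simp add: K_def Lp_norm_nonneg)
  have gap_Lp: "Lp_norm p (x_marginal P1) kernel_gap \<le> K"
  proof -
    have "Lp_norm p (x_marginal P1) kernel_gap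
      = Lp_norm p (x_marginal P1) (\<lambda>x. LINT y|x_marginal P1. \<bar>(\<lambda>(x, y). k1 x y - k2 x y) (x, y)\<bar>)"
      by (simp add: kernel_gap_def[abs_def])
    also have "\<dots> \<le> K"
      unfolding K_def
    proof (rule M.Lp_norm_section_integral_le[OF _ _ p])
      show "(\<lambda>(x, y). k1 x y - k2 x y) \<in> borel_measurable (x_marginal P1 \<Otimes>\<^sub>M x_marginal P1)"
        using borel_measurable_kernel_diff
        by (subst measurable_cong_sets[OF sets_pair_measure_cong[OF sets_marginal sets_marginal] refl])
      show "\<bar>case z of (x, y) \<Rightarrow> k1 x y - k2 x y\<bar> \<le> 2 * \<kappa>\<^sup>2" for z
        using abs_kernel_diff_le by (cases z) simp
    qed
    finally show ?thesis .
  qed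
  have gap_L1: "(LINT x|x_marginal P1. kernel_gap x) \<le> K"
  proof -
    have "(LINT x|x_marginal P1. kernel_gap x) = (LINT x|x_marginal P1. \<bar>kernel_gap x\<bar>)"
      using kernel_gap_bounds(1) by simp
    also have "\<dots> \<le> Lp_norm p (x_marginal P1) kernel_gap"
      using kernel_gap_bounds borel_measurable_kernel_gap p
      by (intro M.expectation_le_Lp_norm[of _ "2 * \<kappa>\<^sup>2"]) (auto cong: measurable_cong_sets)
    finally show ?thesis using gap_Lp by simp
  qed
  \<comment> \<open>The factor 1/2 under the root is given away here.\<close>
  have sqrt_le: "sqrt (c\<^sup>2 * (LINT x|x_marginal P1. kernel_gap x) / (2 * lam1\<^sup>2)) \<le> c / lam1 * sqrt K"
  proof -
    have "c\<^sup>2 * (LINT x|x_marginal P1. kernel_gap x) / (2 * lam1\<^sup>2) \<le> c\<^sup>2 * K / lam1\<^sup>2"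
      using gap_L1 \<open>0 \<le> K\<close> pos by (intro frac_le mult_left_mono) auto
    then have "sqrt (c\<^sup>2 * (LINT x|x_marginal P1. kernel_gap x) / (2 * lam1\<^sup>2)) \<le> sqrt (c\<^sup>2 * K / lam1\<^sup>2)"
      by (rule real_sqrt_le_mono)
    also have "\<dots> = c / lam1 * sqrt K"
      using pos by (simp add: real_sqrt_mult real_sqrt_divide)
    finally show ?thesis .
  qed
  have "Lp_norm p (x_marginal P1) (\<lambda>x. S1.f_svm x - S2.f_svm x)
      \<le> Lp_norm p (x_marginal P1) (\<lambda>x. c / (2 * lam1) * kernel_gap x) + \<kappa> * rkhs_gap"
  proof (rule M.Lp_norm_le_add_const[OF p])
    show "(\<lambda>x. S1.f_svm x - S2.f_svm x) \<in> borel_measurable (x_marginal P1)"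
      using borel_measurable_diff[OF S1.borel_measurable_svm S2.borel_measurable_svm]
      by (simp cong: measurable_cong_sets)
    show "(\<lambda>x. c / (2 * lam1) * kernel_gap x) \<in> borel_measurable (x_marginal P1)"
      using borel_measurable_times[OF borel_measurable_const borel_measurable_kernel_gap]
      by (simp cong: measurable_cong_sets)
    show "0 \<le> c / (2 * lam1) * kernel_gap x \<and> c / (2 * lam1) * kernel_gap x \<le> c / (2 * lam1) * (2 * \<kappa>\<^sup>2)" for x
      using kernel_gap_bounds[of x] pos by (intro conjI mult_left_mono mult_nonneg_nonneg) auto
  qed (use abs_svm_diff_le rkhs_gap_nonneg pos in auto)
  also have "\<dots> = c / (2 * lam1) * Lp_norm p (x_marginal P1) kernel_gap + \<kappa> * rkhs_gap"
    unfolding Lp_norm_scale[OF p] using pos by simp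
  also have "\<dots> \<le> c / (2 * lam1) * K + \<kappa> *
      (c * \<kappa> * tv / (2 * lam1) + \<bar>lam1 - lam2\<bar> * c * \<kappa> / (2 * lam1 * lam2) + c / lam1 * sqrt K)"
    unfolding rkhs_gap_def using gap_Lp sqrt_le pos by (intro add_mono mult_left_mono) auto
  \<comment> \<open>Regularization parameters are lowered to \<open>\<tau>\<close>. The factor 1/2
    survives in the \<open>K\<close> term only; it is dropped from the measure and regularization
    terms.\<close>
  also have "\<dots> \<le> c / (2 * \<tau>) * K + \<kappa> *
      (c * \<kappa> * tv / \<tau> + \<bar>lam1 - lam2\<bar> * c * \<kappa> / (\<tau> * \<tau>) + c / \<tau> * sqrt K)"
  proof -
    have "\<tau> * \<tau> \<le> 2 * lam1 * lam2"
      using mult_mono[OF pos(2,3)] pos mult_pos_pos[OF pos(4,5)] by linarith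
    then show ?thesis
      using pos tv \<open>0 \<le> K\<close>
      by (intro add_mono mult_left_mono mult_right_mono divide_left_mono) auto
  qed
  also have "\<dots> = c / \<tau> * (\<kappa>\<^sup>2 * tv + \<kappa>\<^sup>2 / \<tau> * \<bar>lam1 - lam2\<bar> + 1 / 2 * K + \<kappa> * sqrt K)"
    using pos by (simp add: field_simps power2_eq_square)
  finally show ?thesis .
qed

end

lemma svm_problemI:
  fixes k :: "'x::polish_space \<Rightarrow> 'x \<Rightarrow> real"
  assumes "is_rkhs k H ip" "bounded_kernel k" "kernel_sup_norm k \<le> \<kappa>"
    and "case_prod k \<in> borel_measurable borel"
    and "P \<in> borel_prob_measures Y" "is_loss Y L" "convex_loss Y L" "lipschitz_loss Y L" "0 < lam"
  shows "svm_problem k H ip \<kappa> Y P L (loss_lip Y L) lam"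
proof
  show "sqrt (k x x) \<le> \<kappa>" for x
  proof -
    have "sqrt (k x x) \<le> kernel_sup_norm k"
      unfolding kernel_sup_norm_def using assms(2) by (intro cSUP_upper) (auto simp: bounded_kernel_def)
    then show ?thesis using assms(3) by simp
  qed
qed (use assms abs_loss_diff_le loss_lip_nonneg in auto)

lemma Lp_norm_minus_commute:
  "Lp_norm p M (\<lambda>x. f x - g x) = Lp_norm p M (\<lambda>x. g x - f x)"
  "Lp_norm p N (\<lambda>(x, y). h x y - k x y) = Lp_norm p N (\<lambda>(x, y). k x y - h x y)"
  by (simp_all add: Lp_norm_def abs_minus_commute case_prod_beta')

theorem theorem2p3:
  fixes Y :: "real set"
    and P1 P2 Q :: "('x::polish_space \<times> real) measure"
    and k1 k2 :: "'x \<Rightarrow> 'x \<Rightarrow> real"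
    and H1 H2 :: "('x \<Rightarrow> real) set"
    and ip1 ip2 :: "('x \<Rightarrow> real) \<Rightarrow> ('x \<Rightarrow> real) \<Rightarrow> real"
    and L :: "'x \<Rightarrow> real \<Rightarrow> real \<Rightarrow> real"
    and lam1 lam2 \<kappa> \<tau> p :: real
  assumes "closed Y"
    and "P1 \<in> borel_prob_measures Y" and "P2 \<in> borel_prob_measures Y"
    and "lam1 > 0" and "lam2 > 0"
    and "is_kernel k1" and "is_kernel k2"
    and "case_prod k1 \<in> borel_measurable borel" and "case_prod k2 \<in> borel_measurable borel"
    and "bounded_kernel k1" and "bounded_kernel k2"
    and "is_rkhs k1 H1 ip1" and "is_rkhs k2 H2 ip2"
    and "separable_fspace H1 ip1" and "separable_fspace H2 ip2"
    and "\<kappa> = max (kernel_sup_norm k1) (kernel_sup_norm k2)"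
    and "\<tau> = min lam1 lam2"
    and "is_loss Y L" and "convex_loss Y L" and "lipschitz_loss Y L"
    and "1 \<le> p"
    and "Q \<in> {P1, P2}"
  shows "Lp_norm p (x_marginal Q) (\<lambda>x. svm L P1 lam1 H1 ip1 x - svm L P2 lam2 H2 ip2 x)
    \<le> loss_lip Y L / \<tau> *
       (\<kappa>\<^sup>2 * tv_norm (restrict_space borel (UNIV \<times> Y)) (\<lambda>E. measure P1 E - measure P2 E)
        + \<kappa>\<^sup>2 / \<tau> * \<bar>lam1 - lam2\<bar>
        + 1 / 2 * Lp_norm p (x_marginal Q \<Otimes>\<^sub>M x_marginal Q) (\<lambda>(x, x'). k1 x x' - k2 x x')
        + \<kappa> * sqrt (Lp_norm p (x_marginal Q \<Otimes>\<^sub>M x_marginal Q) (\<lambda>(x, x'). k1 x x' - k2 x x')))"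
proof -
  have problem1: "svm_problem k1 H1 ip1 \<kappa> Y P1 L (loss_lip Y L) lam1"
    using assms by (intro svm_problemI) auto
  have problem2: "svm_problem k2 H2 ip2 \<kappa> Y P2 L (loss_lip Y L) lam2"
    using assms by (intro svm_problemI) auto
  consider "Q = P1" | "Q = P2" using assms by blast
  then show ?thesis
  proof cases
    case 1
    then show ?thesis using Lp_norm_svm_diff_le[OF problem1 problem2 \<open>1 \<le> p\<close> \<open>\<tau> = min lam1 lam2\<close>] by simp
  next
    case 2
    \<comment> \<open>The estimate holds under the measure of its first problem, so the problems are
      exchanged; all terms are symmetric under this exchange.\<close>
    have "\<tau> = min lam2 lam1" using \<open>\<tau> = min lam1 lam2\<close> by simp
    from Lp_norm_svm_diff_le[OF problem2 problem1 \<open>1 \<le> p\<close> this] 2 show ?thesis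
      by (simp only: tv_norm_minus[of _ P1] abs_minus_commute[of lam1]
          Lp_norm_minus_commute(1)[of _ _ "svm L P1 lam1 H1 ip1"] Lp_norm_minus_commute(2)[of _ _ k1])
  qed
qed

end
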